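(* Let $\mathcal L$ be a constant-coefficient linear scalar partial differential operator of order $c$ in $d$ dimensions and let $\boldsymbol c_1,\boldsymbol c_2\in\mathbb R^d$. Translating a multipole expansion of order $p$ in compressed representation around center $\boldsymbol c_1$ to a multipole expansion of order $p$ in compressed representation around center $\boldsymbol c_2$ (the problem defined in the context) can be achieved with $O(p^d)$ operations as $p\to\infty$.
   Context: Notation. $d\ge1$; for $\boldsymbol q\in\mathbb N_0^d$, $|\boldsymbol q|=\sum_i q_i$, $\boldsymbol q!=\prod_i q_i!$, $\boldsymbol x^{\boldsymbol q}=\prod_i x_i^{q_i}$, and $\boldsymbol m\ge\boldsymbol n$, $\boldsymbol n\le\boldsymbol m$ are meant componentwise. $\mathcal M(p)=\{\boldsymbol q\in\mathbb N_0^d:|\boldsymbol q|\le p\}$, $N(p)=|\mathcal M(p)|$. $\mathcal L=\sum_{\boldsymbol m\in\mathcal M(c)}a_{\boldsymbol m}\partial^{\boldsymbol m}$, $a_{\boldsymbol m}\in\mathbb C$, has order $c\ge1$ ($a_{\boldsymbol m}\ne0$ for some $|\boldsymbol m|=c$), and $p\ge c$. Graded monomial ordering: a bijection $\boldsymbol\nu:\mathbb N=\{1,2,\dots\}\to\mathbb N_0^d$ with $\boldsymbol\nu(1)=\boldsymbol 0$; $|\boldsymbol\nu(i)|<|\boldsymbol\nu(j)|\Rightarrow i<j$; and $i<j\Rightarrow\boldsymbol\nu^{-1}(\boldsymbol\nu(i)+\boldsymbol\nu(k))<\boldsymbol\nu^{-1}(\boldsymbol\nu(j)+\boldsymbol\nu(k))$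 for all $i,j,k$. Fix one. Compression. Let $P\in\mathbb C^{N(p-c)\times N(p)}$, $P_{i_1,i_2}=b_{\boldsymbol\nu(i_1),\boldsymbol\nu(i_2)}$, where $b_{\boldsymbol n,\boldsymbol m}=a_{\boldsymbol m-\boldsymbol n}$ if $\boldsymbol m\ge\boldsymbol n$ and $\boldsymbol m-\boldsymbol n\in\mathcal M(c)$, and $0$ otherwise. Let $h(i)$ be the index of the last nonzero column in row $i$ of $P$, $\bar{\boldsymbol j}=\{h(1),\dots,h(N(p-c))\}$ and $\boldsymbol j=\{1,\dots,N(p)\}\setminus\bar{\boldsymbol j}$. The submatrix $P_{[:,\bar{\boldsymbol j}]}$ of the columns $\bar{\boldsymbol j}$ is square and invertible. The decompression matrix $M$, with $N(p)$ rows and columns indexed by $\boldsymbol j$, has $M_{[\boldsymbol j,:]}=I$ and $M_{[\bar{\boldsymbol j},:]}=-P_{[:,\bar{\boldsymbol j}]}^{-1}P_{[:,\boldsymbol j]}$. A multipole expansion of order $p$ in compressed representation is stored as a vector $\boldsymbol\beta=(\boldsymbol\beta_i)_{i\in\boldsymbol j}$ (obtained as $\boldsymbol\beta=M^T\boldsymbol\alpha$ from uncompressed coefficients $\boldsymbol\alpha\in\mathbb C^{N(p)}$). Translation problem (multipole-to-multipole): given $\boldsymbol\beta$ around $\boldsymbol c_1$, let $[E\boldsymbol\beta]_i=\boldsymbol\beta_i$ for $i\in\boldsymbol j$ and $[E\boldsymbol\beta]_i=0$ for $i\in\{1,\dots,N(p)\}\setminus\boldsymbol j$; with $\boldsymbol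 h=\boldsymbol c_2-\boldsymbol c_1$ let $$\boldsymbol\sigma_q=\sum_{i\in\{1,\dots,N(p)\},\ \boldsymbol\nu(i)\le\boldsymbol\nu(q)}\frac{\boldsymbol h^{\boldsymbol\nu(q)-\boldsymbol\nu(i)}}{(\boldsymbol\nu(q)-\boldsymbol\nu(i))!}[E\boldsymbol\beta]_i\qquad(1\le q\le N(p)),$$ and compute the compressed coefficients $\boldsymbol\psi=M^T\boldsymbol\sigma$ around $\boldsymbol c_2$. Operations are scalar arithmetic operations in $\mathbb C$. Implied constants may depend on $d$, $\mathcal L$ and $\boldsymbol\nu$ but not on $p$. *)

theory Defs
  imports "HOL-Analysis.Analysis" "HOL-Library.Monad_Syntax" "HOL-Library.Landau_Symbols"
begin

section \<open>Multi-indices and graded monomial orderings\<close>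

definition mi_deg :: "nat ^ 'd \<Rightarrow> nat" where
  "mi_deg q = (\<Sum>k\<in>UNIV. q $ k)"

definition mi_fact :: "nat ^ 'd \<Rightarrow> nat" where
  "mi_fact q = (\<Prod>k\<in>UNIV. fact (q $ k))"

definition mi_power :: "real ^ 'd \<Rightarrow> nat ^ 'd \<Rightarrow> real" where
  "mi_power x q = (\<Prod>k\<in>UNIV. x $ k ^ q $ k)"

definition mi_upto :: "nat \<Rightarrow> (nat ^ 'd) set" where
  "mi_upto p = {q. mi_deg q \<le> p}"

definition mi_count :: "'d::finite itself \<Rightarrow> nat \<Rightarrow> nat" where
  "mi_count _ p = card (mi_upto p :: (nat ^ 'd) set)"

(* Orderings enumerate the multi-indices by the positive naturals; the value at 0 is irrelevant. *)
definition mi_rank :: "(nat \<Rightarrow> nat ^ 'd) \<Rightarrow> nat ^ 'd \<Rightarrow> nat" where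
  "mi_rank \<nu> = inv_into {1..} \<nu>"

definition graded_monomial_ordering :: "(nat \<Rightarrow> nat ^ 'd) \<Rightarrow> bool" where
  "graded_monomial_ordering \<nu> \<longleftrightarrow>
     bij_betw \<nu> {1..} UNIV \<and>
     \<nu> 1 = 0 \<and>
     (\<forall>i\<ge>1. \<forall>j\<ge>1. mi_deg (\<nu> i) < mi_deg (\<nu> j) \<longrightarrow> i < j) \<and>
     (\<forall>i\<ge>1. \<forall>j\<ge>1. \<forall>k\<ge>1. i < j \<longrightarrow> mi_rank \<nu> (\<nu> i + \<nu> k) < mi_rank \<nu> (\<nu> j + \<nu> k))"


section \<open>Compression\<close>

text \<open>
  The operator is given by its order \<open>c\<close> and its coefficients \<open>a m\<close> for \<open>m \<in> mi_upto c\<close>; values of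
  \<open>a\<close> elsewhere are never used. Matrices are functions of a row and a column index, together with
  explicit index sets, so that submatrices keep the original labels of their rows and columns.
\<close>

definition pde_mat ::
  "(nat ^ 'd \<Rightarrow> complex) \<Rightarrow> nat \<Rightarrow> (nat \<Rightarrow> nat ^ 'd) \<Rightarrow> nat \<Rightarrow> nat \<Rightarrow> complex" where
  "pde_mat a c \<nu> i k =
     (if \<nu> i \<le> \<nu> k \<and> \<nu> k - \<nu> i \<in> mi_upto c then a (\<nu> k - \<nu> i) else 0)"

definition last_col ::
  "(nat ^ 'd \<Rightarrow> complex) \<Rightarrow> nat \<Rightarrow> (nat \<Rightarrow> nat ^ 'd) \<Rightarrow> nat \<Rightarrow> nat \<Rightarrow> nat" where
  "last_col a c \<nu> p i = Max {k \<in> {1..mi_count TYPE('d) p}. pde_mat a c \<nu> i k \<noteq> 0}"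

definition elim_idx ::
  "(nat ^ 'd \<Rightarrow> complex) \<Rightarrow> nat \<Rightarrow> (nat \<Rightarrow> nat ^ 'd) \<Rightarrow> nat \<Rightarrow> nat set" where
  "elim_idx a c \<nu> p = last_col a c \<nu> p ` {1..mi_count TYPE('d) (p - c)}"

definition stored_idx ::
  "(nat ^ 'd \<Rightarrow> complex) \<Rightarrow> nat \<Rightarrow> (nat \<Rightarrow> nat ^ 'd) \<Rightarrow> nat \<Rightarrow> nat set" where
  "stored_idx a c \<nu> p = {1..mi_count TYPE('d) p} - elim_idx a c \<nu> p"

definition is_inverse_mat ::
  "'r set \<Rightarrow> 's set \<Rightarrow> ('r \<Rightarrow> 's \<Rightarrow> complex) \<Rightarrow> ('s \<Rightarrow> 'r \<Rightarrow> complex) \<Rightarrow> bool" where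
  "is_inverse_mat R S A B \<longleftrightarrow>
     (\<forall>i\<in>R. \<forall>k\<in>R. (\<Sum>s\<in>S. A i s * B s k) = (if i = k then 1 else 0)) \<and>
     (\<forall>s\<in>S. \<forall>t\<in>S. (\<Sum>i\<in>R. B s i * A i t) = (if s = t then 1 else 0))"

(* An inverse exists and is unique on the index sets: is_inverse_mat_elim_inv, is_inverse_mat_unique. *)
definition elim_inv ::
  "(nat ^ 'd \<Rightarrow> complex) \<Rightarrow> nat \<Rightarrow> (nat \<Rightarrow> nat ^ 'd) \<Rightarrow> nat \<Rightarrow> nat \<Rightarrow> nat \<Rightarrow> complex" where
  "elim_inv a c \<nu> p =
     (SOME B. is_inverse_mat {1..mi_count TYPE('d) (p - c)} (elim_idx a c \<nu> p) (pde_mat a c \<nu>) B)"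

definition decompression_mat ::
  "(nat ^ 'd \<Rightarrow> complex) \<Rightarrow> nat \<Rightarrow> (nat \<Rightarrow> nat ^ 'd) \<Rightarrow> nat \<Rightarrow> nat \<Rightarrow> nat \<Rightarrow> complex" where
  "decompression_mat a c \<nu> p q l =
     (if q \<in> elim_idx a c \<nu> p
      then - (\<Sum>i\<in>{1..mi_count TYPE('d) (p - c)}. elim_inv a c \<nu> p q i * pde_mat a c \<nu> i l)
      else if q = l then 1 else 0)"


section \<open>The translation problem\<close>

definition embed_stored ::
  "(nat ^ 'd \<Rightarrow> complex) \<Rightarrow> nat \<Rightarrow> (nat \<Rightarrow> nat ^ 'd) \<Rightarrow> nat \<Rightarrow> (nat \<Rightarrow> complex) \<Rightarrow> nat \<Rightarrow> complex" where
  "embed_stored a c \<nu> p \<beta> i = (if i \<in> stored_idx a c \<nu> p then \<beta> i else 0)"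

definition shifted_coeff ::
  "(nat ^ 'd \<Rightarrow> complex) \<Rightarrow> nat \<Rightarrow> (nat \<Rightarrow> nat ^ 'd) \<Rightarrow> nat \<Rightarrow> real ^ 'd \<Rightarrow> (nat \<Rightarrow> complex)
   \<Rightarrow> nat \<Rightarrow> complex" where
  "shifted_coeff a c \<nu> p h \<beta> q =
     (\<Sum>i | i \<in> {1..mi_count TYPE('d) p} \<and> \<nu> i \<le> \<nu> q.
        of_real (mi_power h (\<nu> q - \<nu> i) / real (mi_fact (\<nu> q - \<nu> i))) * embed_stored a c \<nu> p \<beta> i)"

definition translated_coeff ::
  "(nat ^ 'd \<Rightarrow> complex) \<Rightarrow> nat \<Rightarrow> (nat \<Rightarrow> nat ^ 'd) \<Rightarrow> nat \<Rightarrow> real ^ 'd \<Rightarrow> real ^ 'd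
   \<Rightarrow> (nat \<Rightarrow> complex) \<Rightarrow> nat \<Rightarrow> complex" where
  "translated_coeff a c \<nu> p c1 c2 \<beta> l =
     (\<Sum>q\<in>{1..mi_count TYPE('d) p}.
        decompression_mat a c \<nu> p q l * shifted_coeff a c \<nu> p (c2 - c1) \<beta> q)"


section \<open>Arithmetic straight-line programs\<close>

datatype arith_op = Add | Sub | Mul | Div

(* Res k is the result of the k-th instruction, counted from 0. *)
datatype 'v operand = Inp 'v | Res nat

type_synonym 'v instr = "arith_op \<times> 'v operand \<times> 'v operand"

fun apply_op :: "arith_op \<Rightarrow> complex \<Rightarrow> complex \<Rightarrow> complex option" where
  "apply_op Add x y = Some (x + y)"
| "apply_op Sub x y = Some (x - y)"
| "apply_op Mul x y = Some (x * y)"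
| "apply_op Div x y = (if y = 0 then None else Some (x / y))"

fun fetch :: "('v \<rightharpoonup> complex) \<Rightarrow> complex list \<Rightarrow> 'v operand \<Rightarrow> complex option" where
  "fetch inp rs (Inp v) = inp v"
| "fetch inp rs (Res k) = (if k < length rs then Some (rs ! k) else None)"

fun run :: "('v \<rightharpoonup> complex) \<Rightarrow> 'v instr list \<Rightarrow> complex list \<Rightarrow> complex list option" where
  "run inp [] rs = Some rs"
| "run inp ((f, x, y) # prog) rs =
     do { u \<leftarrow> fetch inp rs x; v \<leftarrow> fetch inp rs y; w \<leftarrow> apply_op f u v; run inp prog (rs @ [w]) }"

(* The run must not divide by zero or access undefined operands. *)
definition computes_on ::
  "('v \<rightharpoonup> complex) \<Rightarrow> 'v instr list \<Rightarrow> (nat \<Rightarrow> 'v operand) \<Rightarrow> nat set \<Rightarrow> (nat \<Rightarrow> complex) \<Rightarrow> bool" where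
  "computes_on inp prog out J \<psi> \<longleftrightarrow>
     (\<exists>rs. run inp prog [] = Some rs \<and> (\<forall>l\<in>J. fetch inp rs (out l) = Some (\<psi> l)))"

text \<open>
  The operands available at no cost are the constants 0 and 1, the coefficients of the operator, the
  coordinates of both centers, and the stored coefficients of the given expansion. Every other
  number, such as the power of a coordinate, a factorial, or an entry of the decompression matrix,
  has to be computed from these by counted operations.
\<close>

datatype 'd tr_input = Zero | One | Coeff "nat ^ 'd" | Center1 'd | Center2 'd | Stored nat

fun translation_input ::
  "(nat ^ 'd \<Rightarrow> complex) \<Rightarrow> nat \<Rightarrow> (nat \<Rightarrow> nat ^ 'd) \<Rightarrow> nat \<Rightarrow> real ^ 'd \<Rightarrow> real ^ 'd
   \<Rightarrow> (nat \<Rightarrow> complex) \<Rightarrow> 'd tr_input \<rightharpoonup> complex" where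
  "translation_input a c \<nu> p c1 c2 \<beta> Zero = Some 0"
| "translation_input a c \<nu> p c1 c2 \<beta> One = Some 1"
| "translation_input a c \<nu> p c1 c2 \<beta> (Coeff m) = (if m \<in> mi_upto c then Some (a m) else None)"
| "translation_input a c \<nu> p c1 c2 \<beta> (Center1 k) = Some (of_real (c1 $ k))"
| "translation_input a c \<nu> p c1 c2 \<beta> (Center2 k) = Some (of_real (c2 $ k))"
| "translation_input a c \<nu> p c1 c2 \<beta> (Stored i) = (if i \<in> stored_idx a c \<nu> p then Some (\<beta> i) else None)"


section \<open>Invertibility of the eliminated block\<close>

lemma finite_mi_upto: "finite (mi_upto p :: (nat ^ 'd) set)"
proof -
  have "mi_upto p \<subseteq> vec_lambda ` (UNIV \<rightarrow>\<^sub>E {..p} :: ('d \<Rightarrow> nat) set)"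
  proof
    fix q :: "nat ^ 'd" assume q: "q \<in> mi_upto p"
    have "q $ k \<le> p" for k
      using q member_le_sum[of k UNIV "\<lambda>k. q $ k"] by (simp add: mi_upto_def mi_deg_def)
    then have "vec_nth q \<in> (UNIV \<rightarrow>\<^sub>E {..p})" by auto
    moreover have "q = vec_lambda (vec_nth q)" by simp
    ultimately show "q \<in> vec_lambda ` (UNIV \<rightarrow>\<^sub>E {..p})" by blast
  qed
  then show ?thesis by (rule finite_subset) (simp add: finite_PiE)
qed

lemma mi_rank:
  assumes "graded_monomial_ordering \<nu>"
  shows "mi_rank \<nu> m \<ge> 1" "\<nu> (mi_rank \<nu> m) = m" "i \<ge> 1 \<Longrightarrow> mi_rank \<nu> (\<nu> i) = i"
proof -
  have b: "bij_betw \<nu> {1..} UNIV" using assms by (simp add: graded_monomial_ordering_def)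
  then have "m \<in> \<nu> ` {1..}" by (simp add: bij_betw_def)
  then show "mi_rank \<nu> m \<ge> 1" "\<nu> (mi_rank \<nu> m) = m"
    unfolding mi_rank_def using inv_into_into[of m \<nu> "{1..}"] by (auto simp: f_inv_into_f)
  show "i \<ge> 1 \<Longrightarrow> mi_rank \<nu> (\<nu> i) = i"
    unfolding mi_rank_def using b by (simp add: bij_betw_def)
qed

lemma mi_rank_image:
  fixes \<nu> :: "nat \<Rightarrow> nat ^ 'd"
  assumes \<nu>: "graded_monomial_ordering \<nu>"
  shows "mi_rank \<nu> ` mi_upto p = {1..mi_count TYPE('d) p}"
proof -
  let ?I = "mi_rank \<nu> ` mi_upto p"
  have fin: "finite ?I" by (simp add: finite_mi_upto)
  have "inj (mi_rank \<nu>)" by (metis injI mi_rank(2)[OF \<nu>])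
  then have card: "card ?I = mi_count TYPE('d) p"
    by (simp add: mi_count_def card_image inj_on_subset)
  have down: "k \<in> ?I" if "1 \<le> k" "k \<le> k'" "k' \<in> ?I" for k k'
  proof -
    have "mi_deg (\<nu> k') \<le> p" using that(3) \<nu> by (auto simp: mi_upto_def mi_rank)
    moreover have "mi_deg (\<nu> k') < mi_deg (\<nu> k) \<longrightarrow> k' < k"
      using \<nu> that by (simp add: graded_monomial_ordering_def)
    ultimately have "\<nu> k \<in> mi_upto p" using that by (auto simp: mi_upto_def)
    then show ?thesis using mi_rank(3)[OF \<nu> that(1)] by (metis imageI)
  qed
  have "0 \<in> (mi_upto p :: (nat ^ 'd) set)" by (simp add: mi_upto_def mi_deg_def)
  then have ne: "?I \<noteq> {}" by blast
  have "?I = {1..Max ?I}"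
  proof (intro equalityI subsetI)
    fix k assume "k \<in> ?I" then show "k \<in> {1..Max ?I}"
      using fin mi_rank(1)[OF \<nu>] by auto
  next
    fix k assume "k \<in> {1..Max ?I}" then show "k \<in> ?I"
      using down Max_in[OF fin ne] by auto
  qed
  then show ?thesis using card by (metis card_atLeastAtMost diff_Suc_1 Suc_eq_plus1)
qed

lemma last_col_eq:
  fixes a :: "nat ^ 'd \<Rightarrow> complex"
  assumes \<nu>: "graded_monomial_ordering \<nu>" and a: "\<exists>m. mi_deg m = c \<and> a m \<noteq> 0" and "c \<le> p"
  obtains m where "mi_deg m \<le> c" "a m \<noteq> 0"
    "\<And>i. i \<in> {1..mi_count TYPE('d) (p - c)} \<Longrightarrow> last_col a c \<nu> p i = mi_rank \<nu> (\<nu> i + m)"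
    "\<And>i k. 1 \<le> i \<Longrightarrow> 1 \<le> k \<Longrightarrow> pde_mat a c \<nu> i k \<noteq> 0 \<Longrightarrow> k \<le> mi_rank \<nu> (\<nu> i + m)"
proof -
  let ?S = "{m \<in> mi_upto c. a m \<noteq> 0}"
  have S: "finite ?S" "?S \<noteq> {}" using a finite_mi_upto[of c] by (auto simp: mi_upto_def)
  then have "Max (mi_rank \<nu> ` ?S) \<in> mi_rank \<nu> ` ?S" by (intro Max_in) auto
  then obtain m where m: "m \<in> ?S" "mi_rank \<nu> m = Max (mi_rank \<nu> ` ?S)" by auto
  have max: "k \<le> mi_rank \<nu> (\<nu> i + m)" if i: "1 \<le> i" and k: "1 \<le> k" and nz: "pde_mat a c \<nu> i k \<noteq> 0" for i k
  proof -
    define n where "n = \<nu> k - \<nu> i"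
    have n: "n \<in> ?S" and le: "\<nu> i \<le> \<nu> k" using nz by (auto simp: pde_mat_def n_def split: if_splits)
    have eq: "\<nu> k = n + \<nu> i" using le by (simp add: n_def vec_eq_iff less_eq_vec_def)
    have "mi_rank \<nu> n \<le> mi_rank \<nu> m" using n m(2) S by simp
    moreover have "mi_rank \<nu> n < mi_rank \<nu> m \<longrightarrow>
        mi_rank \<nu> (\<nu> (mi_rank \<nu> n) + \<nu> i) < mi_rank \<nu> (\<nu> (mi_rank \<nu> m) + \<nu> i)"
      using \<nu> i mi_rank(1)[OF \<nu>] by (simp add: graded_monomial_ordering_def)
    moreover have "mi_rank \<nu> n = mi_rank \<nu> m \<longrightarrow> n = m" by (metis mi_rank(2)[OF \<nu>])
    ultimately have "mi_rank \<nu> (n + \<nu> i) \<le> mi_rank \<nu> (m + \<nu> i)"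
      using mi_rank(2)[OF \<nu>] by fastforce
    then show ?thesis using mi_rank(3)[OF \<nu> k] eq by (simp add: add.commute)
  qed
  have "last_col a c \<nu> p i = mi_rank \<nu> (\<nu> i + m)" if i: "i \<in> {1..mi_count TYPE('d) (p - c)}" for i
  proof -
    have "i \<in> mi_rank \<nu> ` mi_upto (p - c)" using i mi_rank_image[OF \<nu>] by blast
    then have "mi_deg (\<nu> i) \<le> p - c" using mi_rank(2)[OF \<nu>] by (auto simp: mi_upto_def)
    moreover have "mi_deg (\<nu> i + m) = mi_deg (\<nu> i) + mi_deg m"
      by (simp add: mi_deg_def sum.distrib)
    ultimately have "\<nu> i + m \<in> mi_upto p"
      using m(1) \<open>c \<le> p\<close> unfolding mi_upto_def mem_Collect_eq by linarith
    then have *: "mi_rank \<nu> (\<nu> i + m) \<in> {1..mi_count TYPE('d) p}" using mi_rank_image[OF \<nu>] by blast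
    have "\<nu> i + m - \<nu> i = m" by (simp add: vec_eq_iff)
    then have "pde_mat a c \<nu> i (mi_rank \<nu> (\<nu> i + m)) \<noteq> 0"
      using m(1) by (simp add: pde_mat_def mi_rank(2)[OF \<nu>] less_eq_vec_def)
    then show ?thesis unfolding last_col_def using * max i by (intro Max_eqI) auto
  qed
  then show thesis using that m(1) max by (auto simp: mi_upto_def)
qed

lemma is_inverse_mat_insert:
  assumes B: "is_inverse_mat R S A B" and fin: "finite R" "finite S"
    and new: "r \<notin> R" "s \<notin> S" and diag: "A r s \<noteq> 0" and zero: "\<And>i. i \<in> R \<Longrightarrow> A i s = 0"
  shows "\<exists>B'. is_inverse_mat (insert r R) (insert s S) A B'"
proof -
  define B' where "B' = (\<lambda>u i. if u = s
      then if i = r then 1 / A r s else - (\<Sum>t\<in>S. A r t * B t i) / A r s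
      else if i = r then 0 else B u i)"
  have old: "B' u i = B u i" if "u \<in> S" "i \<in> R" for u i using that new by (auto simp: B'_def)
  have col: "B' u r = 0" if "u \<in> S" for u using that new by (auto simp: B'_def)
  have row: "B' s i = - (\<Sum>t\<in>S. A r t * B t i) / A r s" if "i \<in> R" for i
    using that new by (auto simp: B'_def)
  have cor: "B' s r = 1 / A r s" by (simp add: B'_def)
  have AB: "(\<Sum>u\<in>S. A i u * B u k) = (if i = k then 1 else 0)" if "i \<in> R" "k \<in> R" for i k
    using B that unfolding is_inverse_mat_def by blast
  have BA: "(\<Sum>i\<in>R. B u i * A i t) = (if u = t then 1 else 0)" if "u \<in> S" "t \<in> S" for u t
    using B that unfolding is_inverse_mat_def by blast
  have last: "(\<Sum>i\<in>R. B' s i * A i t) = - A r t / A r s" if t: "t \<in> S" for t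
  proof -
    have "(\<Sum>i\<in>R. B' s i * A i t) = (\<Sum>i\<in>R. \<Sum>u\<in>S. - (A r u / A r s) * (B u i * A i t))"
      by (intro sum.cong refl)
        (simp add: row sum_distrib_right sum_divide_distrib sum_negf mult.assoc)
    also have "\<dots> = (\<Sum>u\<in>S. - (A r u / A r s) * (\<Sum>i\<in>R. B u i * A i t))"
      by (subst sum.swap) (simp only: sum_distrib_left)
    also have "\<dots> = (\<Sum>u\<in>S. if t = u then - (A r u / A r s) else 0)"
      by (intro sum.cong refl) (use BA[OF _ t] in auto)
    also have "\<dots> = - A r t / A r s" using t fin by simp
    finally show ?thesis .
  qed
  have "is_inverse_mat (insert r R) (insert s S) A B'"
    unfolding is_inverse_mat_def
  proof (intro conjI ballI)
    fix i k assume ik: "i \<in> insert r R" "k \<in> insert r R"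
    have "(\<Sum>u\<in>S. A i u * B' u k) = (\<Sum>u\<in>S. A i u * B u k)" if "k \<in> R"
      by (rule sum.cong) (use old that in auto)
    moreover have "(\<Sum>u\<in>S. A i u * B' u r) = 0"
      by (rule sum.neutral) (use col in auto)
    ultimately show "(\<Sum>u\<in>insert s S. A i u * B' u k) = (if i = k then 1 else 0)"
      using ik new fin diag zero AB cor row by auto
  next
    fix u t assume ut: "u \<in> insert s S" "t \<in> insert s S"
    have "(\<Sum>i\<in>R. B' u i * A i t) = (\<Sum>i\<in>R. B u i * A i t)" if "u \<in> S"
      by (rule sum.cong) (use old that in auto)
    moreover have "(\<Sum>i\<in>R. B' u i * A i s) = 0"
      by (rule sum.neutral) (use zero in auto)
    ultimately show "(\<Sum>i\<in>insert r R. B' u i * A i t) = (if u = t then 1 else 0)"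
      using ut new fin diag BA last cor col by auto
  qed
  then show ?thesis by blast
qed

lemma lower_triangular_inverse:
  assumes "inj_on g {1..n::nat}"
    and "\<And>i. i \<in> {1..n} \<Longrightarrow> A i (g i) \<noteq> 0"
    and "\<And>i k. i \<in> {1..n} \<Longrightarrow> k \<in> {1..n} \<Longrightarrow> i < k \<Longrightarrow> A i (g k) = 0"
  shows "\<exists>B. is_inverse_mat {1..n} (g ` {1..n}) A B"
  using assms
proof (induction n)
  case 0
  then show ?case by (simp add: is_inverse_mat_def)
next
  case (Suc n)
  have "\<exists>B. is_inverse_mat {1..n} (g ` {1..n}) A B"
  proof (rule Suc.IH)
    show "inj_on g {1..n}" using Suc.prems(1) by (rule inj_on_subset) auto
  qed (use Suc.prems(2,3) in auto)
  then obtain B where B: "is_inverse_mat {1..n} (g ` {1..n}) A B" by blast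
  have "\<exists>B'. is_inverse_mat (insert (Suc n) {1..n}) (insert (g (Suc n)) (g ` {1..n})) A B'"
  proof (rule is_inverse_mat_insert[OF B])
    show "g (Suc n) \<notin> g ` {1..n}"
      using inj_on_image_mem_iff[OF Suc.prems(1), of "Suc n" "{1..n}"] by auto
  qed (use Suc.prems(2,3) in auto)
  moreover have "insert (Suc n) {1..n} = {1..Suc n}" by auto
  ultimately show ?case by (metis image_insert)
qed

lemma is_inverse_mat_elim_inv:
  fixes a :: "nat ^ 'd \<Rightarrow> complex"
  assumes \<nu>: "graded_monomial_ordering \<nu>" and a: "\<exists>m. mi_deg m = c \<and> a m \<noteq> 0" and "c \<le> p"
  shows "is_inverse_mat {1..mi_count TYPE('d) (p - c)} (elim_idx a c \<nu> p) (pde_mat a c \<nu>)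
           (elim_inv a c \<nu> p)"
proof -
  let ?n = "mi_count TYPE('d) (p - c)" and ?g = "last_col a c \<nu> p"
  obtain m where m: "mi_deg m \<le> c" "a m \<noteq> 0"
    "\<And>i. i \<in> {1..?n} \<Longrightarrow> ?g i = mi_rank \<nu> (\<nu> i + m)"
    "\<And>i k. 1 \<le> i \<Longrightarrow> 1 \<le> k \<Longrightarrow> pde_mat a c \<nu> i k \<noteq> 0 \<Longrightarrow> k \<le> mi_rank \<nu> (\<nu> i + m)"
    using last_col_eq[OF \<nu> a \<open>c \<le> p\<close>] by metis
  have mono: "?g i < ?g k" if ik: "i \<in> {1..?n}" "k \<in> {1..?n}" "i < k" for i k
  proof -
    have "mi_rank \<nu> (\<nu> i + \<nu> (mi_rank \<nu> m)) < mi_rank \<nu> (\<nu> k + \<nu> (mi_rank \<nu> m))"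
      using \<nu> ik mi_rank(1)[OF \<nu>, of m] by (simp add: graded_monomial_ordering_def)
    then show ?thesis using ik m(3) by (simp add: mi_rank(2)[OF \<nu>])
  qed
  have "\<exists>B. is_inverse_mat {1..?n} (?g ` {1..?n}) (pde_mat a c \<nu>) B"
  proof (rule lower_triangular_inverse)
    show "inj_on ?g {1..?n}"
      by (rule inj_onI) (metis mono less_irrefl linorder_less_linear)
  next
    fix i assume i: "i \<in> {1..?n}"
    have "\<nu> i + m - \<nu> i = m" by (simp add: vec_eq_iff)
    then show "pde_mat a c \<nu> i (?g i) \<noteq> 0"
      using m(1,2) m(3)[OF i] by (simp add: pde_mat_def mi_rank(2)[OF \<nu>] less_eq_vec_def mi_upto_def)
  next
    fix i k assume ik: "i \<in> {1..?n}" "k \<in> {1..?n}" "i < k"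
    have "1 \<le> ?g k" using m(3) ik mi_rank(1)[OF \<nu>] by simp
    then have "pde_mat a c \<nu> i (?g k) \<noteq> 0 \<longrightarrow> ?g k \<le> ?g i" using m(3,4) ik by auto
    then show "pde_mat a c \<nu> i (?g k) = 0" using mono[OF ik] by auto
  qed
  then show ?thesis
    unfolding elim_inv_def elim_idx_def by (rule someI_ex)
qed

lemma is_inverse_mat_unique:
  assumes B: "is_inverse_mat R S A B" and C: "is_inverse_mat R S A C"
    and fin: "finite R" "finite S" and s: "s \<in> S" and i: "i \<in> R"
  shows "B s i = C s i"
proof -
  have "B s i = (\<Sum>k\<in>R. if i = k then B s k else 0)" using i fin by simp
  also have "\<dots> = (\<Sum>k\<in>R. B s k * (\<Sum>t\<in>S. A k t * C t i))"
    by (intro sum.cong refl) (use C i in \<open>auto simp: is_inverse_mat_def\<close>)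
  also have "\<dots> = (\<Sum>t\<in>S. (\<Sum>k\<in>R. B s k * A k t) * C t i)"
    by (simp add: sum_distrib_left sum_distrib_right mult.assoc) (rule sum.swap)
  also have "\<dots> = (\<Sum>t\<in>S. if s = t then C t i else 0)"
    by (intro sum.cong refl) (use B s in \<open>auto simp: is_inverse_mat_def\<close>)
  also have "\<dots> = C s i" using s fin by simp
  finally show ?thesis .
qed

end

theory Submission
  imports Defs
begin

text \<open>
  Let \<open>m\<close> be the leading exponent of the operator: the last one in the ordering with a nonzero
  coefficient. The ordering is graded, so \<open>|m| = c\<close>. The last nonzero column in the row of \<open>n\<close> is that of
  \<open>n + m\<close>, so a column is eliminated exactly if its multi-index is \<open>\<ge> m\<close>. Hence every stored
  multi-index \<open>q\<close> has \<open>q\<^sub>k < m\<^sub>k\<close> for some axis \<open>k\<close>, and the stored data lie on the \<open>\<Sum>k. m\<^sub>k = c\<close>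
  slices \<open>q\<^sub>k = j\<close> with \<open>j < m\<^sub>k\<close>, each with \<open>O(p\<^sup>d\<^sup>-\<^sup>1)\<close> points
  (\<open>leading_exponent\<close>).

  The translation weight \<open>h\<^sup>n / n!\<close> is a product over the axes, so a shift can be done one axis at a
  time, at \<open>O(p)\<close> operations per point and axis. On all \<open>O(p\<^sup>d)\<close> points this would be one factor \<open>p\<close> too
  expensive. Instead, each slice is first shifted along the \<open>d - 1\<close> axes that lie in it, which costs
  \<open>O(p\<^sup>d\<^sup>-\<^sup>1 \<cdot> p)\<close>. The remaining shift, across the slice, has a single source per target, so
  that it costs \<open>O(1)\<close> for each of the \<open>O(p\<^sup>d)\<close> targets (\<open>derivable_shift_of_slices\<close>).

  For the compression, write \<open>\<psi>\<^sub>l = \<sigma>\<^sub>l - \<Sum>i. P\<^sub>i\<^sub>l w\<^sub>i\<close>, where \<open>w\<close> solves the transposed system of the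
  eliminated block with right-hand side \<open>\<sigma>\<close> (\<open>translated_coeff_eq\<close>). The block is triangular, and each
  column of \<open>P\<close> has at most \<open>N(c)\<close> nonzero entries, all of them coefficients of the operator. So
  back substitution and the final subtraction take \<open>O(1)\<close> operations per index (\<open>derivable_compress\<close>),
  and no entry of the inverse or of the decompression matrix is ever computed.

  The instructions are never listed explicitly. The calculus below only records that some numbers,
  as functions of the input, are obtained from others by a given number of operations; a program of that
  length then exists by \<open>program_of_derivable\<close>.
\<close>

section \<open>A calculus of operation counts\<close>

text \<open>
  A number occurring in a computation is modelled by its dependence \<open>z\<close> on the input \<open>e\<close> (here both
  centers and the stored coefficients). Since all \<open>e\<close> share the same operations, the program
  behind such a derivation cannot depend on the input.
\<close>
inductive extends_by :: "('e \<Rightarrow> complex) set \<Rightarrow> nat \<Rightarrow> ('e \<Rightarrow> complex) set \<Rightarrow> bool" for V where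
  start: "extends_by V 0 V"
| step: "extends_by V n W \<Longrightarrow> x \<in> W \<Longrightarrow> y \<in> W \<Longrightarrow> (\<And>e. apply_op f (x e) (y e) = Some (z e))
    \<Longrightarrow> extends_by V (Suc n) (insert z W)"

definition derivable :: "('e \<Rightarrow> complex) set \<Rightarrow> nat \<Rightarrow> ('e \<Rightarrow> complex) set \<Rightarrow> bool" where
  "derivable V n F \<longleftrightarrow> (\<exists>k W. k \<le> n \<and> extends_by V k W \<and> F \<subseteq> W)"

lemma extends_by_subset: "extends_by V n W \<Longrightarrow> V \<subseteq> W"
  by (induction rule: extends_by.induct) auto

lemma extends_by_trans:
  assumes "extends_by U k X" "extends_by V n W" "U \<subseteq> W"
  shows "extends_by V (n + k) (W \<union> X)"
  using assms
proof (induction rule: extends_by.induct)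
  case start
  then show ?case by (simp add: Un_absorb2)
next
  case (step k X x y f z)
  have "extends_by V (Suc (n + k)) (insert z (W \<union> X))"
    by (rule extends_by.step[of V "n + k" "W \<union> X" x y f z]) (use step in auto)
  then show ?case by simp
qed

lemma derivable_accumulate:
  assumes "derivable V n F" "derivable (V \<union> F) k G"
  shows "derivable V (n + k) (F \<union> G)"
proof -
  obtain n' W where W: "n' \<le> n" "extends_by V n' W" "F \<subseteq> W"
    using assms(1) by (auto simp: derivable_def)
  obtain k' X where X: "k' \<le> k" "extends_by (V \<union> F) k' X" "G \<subseteq> X"
    using assms(2) by (auto simp: derivable_def)
  have "extends_by V (n' + k') (W \<union> X)"
    using extends_by_trans[OF X(2) W(2)] extends_by_subset[OF W(2)] W(3) by auto
  then show ?thesis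
    unfolding derivable_def using W X by (intro exI[of _ "n' + k'"] exI[of _ "W \<union> X"]) auto
qed

lemma derivable_refl: "F \<subseteq> V \<Longrightarrow> derivable V n F"
  unfolding derivable_def using extends_by.start by blast

lemma derivable_mono:
  assumes "derivable V n F" "V \<subseteq> V'" "n \<le> n'" "F' \<subseteq> F"
  shows "derivable V' n' F'"
proof -
  obtain k W where W: "k \<le> n" "extends_by V k W" "F \<subseteq> W"
    using assms(1) by (auto simp: derivable_def)
  have "extends_by V' (0 + k) (V' \<union> W)"
    using extends_by_trans[OF W(2) extends_by.start assms(2)] .
  then show ?thesis
    unfolding derivable_def using W assms by (intro exI[of _ k] exI[of _ "V' \<union> W"]) auto
qed

lemma derivable_trans:
  assumes "derivable V n F" "derivable (V \<union> F) k G"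
  shows "derivable V (n + k) G"
  by (rule derivable_mono[OF derivable_accumulate[OF assms]]) auto

lemma derivable_op:
  assumes "x \<in> V" "y \<in> V" "\<And>e. apply_op f (x e) (y e) = Some (z e)"
  shows "derivable V 1 {z}"
  unfolding derivable_def using extends_by.step[OF extends_by.start assms] by auto

text \<open>
  The rule for recurrences: a family costs \<open>n\<close> per member if each member costs \<open>n\<close> once the members
  of smaller rank are known.
\<close>
lemma derivable_family:
  fixes r :: "'i \<Rightarrow> nat"
  assumes "finite A"
    and "\<And>x. x \<in> A \<Longrightarrow> derivable (V \<union> f ` {y \<in> A. r y < r x}) n {f x}"
  shows "derivable V (card A * n) (f ` A)"
  using assms
proof (induction rule: finite_ranking_induct[where f = r])
  case empty
  then show ?case by (simp add: derivable_refl)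
next
  case (insert x S)
  show ?case
  proof (cases "x \<in> S")
    case True
    then show ?thesis using insert by (simp add: insert_absorb)
  next
    case False
    have eq: "{y \<in> insert x S. r y < r z} = {y \<in> S. r y < r z}" if "z \<in> insert x S" for z
      using insert.hyps(2) that by fastforce
    have IH: "derivable V (card S * n) (f ` S)"
      by (rule insert.IH) (use insert.prems eq in fastforce)
    have "derivable (V \<union> f ` S) n {f x}"
      by (rule derivable_mono[OF insert.prems[of x]]) (use eq in auto)
    from derivable_accumulate[OF IH this] show ?thesis
      using False insert.hyps(1) by (simp add: add.commute)
  qed
qed

lemma derivable_each:
  assumes "finite A" "\<And>x. x \<in> A \<Longrightarrow> derivable V n {f x}"
  shows "derivable V (card A * n) (f ` A)"
  by (rule derivable_family[where r = "\<lambda>_. 0"]) (use assms in auto)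

lemma derivable_UN:
  assumes "finite A" "\<And>x. x \<in> A \<Longrightarrow> derivable V n (F x)"
  shows "derivable V (card A * n) (\<Union>x\<in>A. F x)"
  using assms
proof (induction rule: finite_induct)
  case empty
  then show ?case by (simp add: derivable_refl)
next
  case (insert x A)
  have "derivable (V \<union> F x) (card A * n) (\<Union>x\<in>A. F x)"
    by (rule derivable_mono[OF insert.IH]) (use insert.prems in auto)
  then have "derivable V (n + card A * n) (F x \<union> (\<Union>x\<in>A. F x))"
    using insert.prems by (intro derivable_accumulate) simp_all
  then show ?case using insert.hyps by simp
qed

lemma derivable_sum_mult:
  assumes "finite A" "(\<lambda>_. 0) \<in> V" "\<And>i. i \<in> A \<Longrightarrow> g i \<in> V" "\<And>i. i \<in> A \<Longrightarrow> f i \<in> V"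
  shows "derivable V (2 * card A) {\<lambda>e. \<Sum>i\<in>A. g i e * f i e}"
  using assms
proof (induction rule: finite_induct)
  case empty
  then show ?case by (simp add: derivable_refl)
next
  case (insert x A)
  let ?s = "\<lambda>e. \<Sum>i\<in>A. g i e * f i e" and ?m = "\<lambda>e. g x e * f x e"
  have s: "derivable V (2 * card A) {?s}" using insert by simp
  have m: "derivable (V \<union> {?s}) 1 {?m}"
    by (rule derivable_op[where f = Mul and x = "g x" and y = "f x"]) (use insert.prems in auto)
  have "derivable (V \<union> {?s} \<union> {?m}) 1 {\<lambda>e. ?m e + ?s e}"
    by (rule derivable_op[where f = Add and x = ?m and y = ?s]) auto
  from derivable_trans[OF s derivable_trans[OF m this]]
  show ?case using insert.hyps by simp
qed

lemma run_append: "run inp (P @ Q) rs = Option.bind (run inp P rs) (run inp Q)"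
  by (induction inp P rs rule: run.induct) (auto intro!: Option.bind_cong)

lemma length_run: "run inp P rs = Some rs' \<Longrightarrow> length rs' = length rs + length P"
  by (induction inp P rs arbitrary: rs' rule: run.induct) (auto split: Option.bind_splits)

lemma fetch_append: "fetch inp rs v = Some x \<Longrightarrow> fetch inp (rs @ ss) v = Some x"
  by (cases v) (auto simp: nth_append split: if_splits)

text \<open>
  Each derivation step becomes one instruction. The operand of an older number stays valid because
  results are only appended.
\<close>
lemma program_of_extension:
  fixes inp :: "'e \<Rightarrow> 'v \<rightharpoonup> complex"
  assumes "extends_by {z. \<exists>v. \<forall>e. inp e v = Some (z e)} n W"
  shows "\<exists>P. length P = n \<and> (\<forall>e. run (inp e) P [] \<noteq> None) \<and>
    (\<forall>z\<in>W. \<exists>v. \<forall>e. fetch (inp e) (the (run (inp e) P [])) v = Some (z e))"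
  using assms
proof (induction rule: extends_by.induct)
  case start
  have "\<exists>v. \<forall>e. fetch (inp e) [] v = Some (z e)" if "\<forall>e. inp e v = Some (z e)" for z v
    using that by (intro exI[of _ "Inp v"]) simp
  then show ?case by (intro exI[of _ "[]"]) auto
next
  case (step n W x y f z)
  then obtain P where P: "length P = n" "\<And>e. run (inp e) P [] \<noteq> None"
    and W: "\<And>z. z \<in> W \<Longrightarrow> \<exists>v. \<forall>e. fetch (inp e) (the (run (inp e) P [])) v = Some (z e)" by blast
  define rs where "rs e = the (run (inp e) P [])" for e
  have rs: "run (inp e) P [] = Some (rs e)" for e using P(2)[of e] by (auto simp: rs_def)
  have len: "length (rs e) = n" for e using length_run[OF rs] P(1) by simp
  obtain u v where u: "\<And>e. fetch (inp e) (rs e) u = Some (x e)"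
    and v: "\<And>e. fetch (inp e) (rs e) v = Some (y e)"
    using W[OF step.hyps(2)] W[OF step.hyps(3)] unfolding rs_def by blast
  have run: "run (inp e) (P @ [(f, u, v)]) [] = Some (rs e @ [z e])" for e
    by (simp add: run_append rs u v step.hyps(4))
  have "\<exists>v. \<forall>e. fetch (inp e) (rs e @ [z e]) v = Some (z' e)" if "z' \<in> insert z W" for z'
  proof (cases "z' = z")
    case True
    then show ?thesis by (intro exI[of _ "Res n"]) (simp add: nth_append len)
  next
    case False
    then show ?thesis using that W[of z'] fetch_append unfolding rs_def by blast
  qed
  then show ?case using P(1) by (intro exI[of _ "P @ [(f, u, v)]"]) (simp add: run)
qed

lemma program_of_derivable:
  fixes inp :: "'e \<Rightarrow> 'v \<rightharpoonup> complex"
  assumes "derivable {z. \<exists>v. \<forall>e. inp e v = Some (z e)} n (\<psi> ` J)"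
  shows "\<exists>P out. length P \<le> n \<and> (\<forall>e. computes_on (inp e) P out J (\<lambda>l. \<psi> l e))"
proof -
  obtain k W where k: "k \<le> n" "extends_by {z. \<exists>v. \<forall>e. inp e v = Some (z e)} k W" "\<psi> ` J \<subseteq> W"
    using assms by (auto simp: derivable_def)
  obtain P where P: "length P = k" "\<And>e. run (inp e) P [] \<noteq> None"
    "\<And>z. z \<in> W \<Longrightarrow> \<exists>v. \<forall>e. fetch (inp e) (the (run (inp e) P [])) v = Some (z e)"
    using program_of_extension[OF k(2)] by blast
  have "\<forall>l\<in>J. \<exists>v. \<forall>e. fetch (inp e) (the (run (inp e) P [])) v = Some (\<psi> l e)"
    using P(3) k(3) by blast
  then obtain out where
    "\<forall>l\<in>J. \<forall>e. fetch (inp e) (the (run (inp e) P [])) (out l) = Some (\<psi> l e)" by metis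
  moreover have "run (inp e) P [] = Some (the (run (inp e) P []))" for e
    using P(2)[of e] by auto
  ultimately have "\<forall>e. computes_on (inp e) P out J (\<lambda>l. \<psi> l e)"
    unfolding computes_on_def by blast
  then show ?thesis using P(1) k(1) by blast
qed

section \<open>Shifting along the axes\<close>

text \<open>
  The convolution with the product weight \<open>t\<close>, restricted to the axes in \<open>D\<close>: the other
  coordinates of source and target agree.
\<close>
definition partial_shift ::
  "('d \<Rightarrow> nat \<Rightarrow> complex) \<Rightarrow> (nat ^ 'd \<Rightarrow> complex) \<Rightarrow> 'd set \<Rightarrow> nat ^ 'd \<Rightarrow> complex" where
  "partial_shift t x D q =
     (\<Sum>i | i \<le> q \<and> (\<forall>k. k \<notin> D \<longrightarrow> i $ k = q $ k). (\<Prod>k\<in>D. t k (q $ k - i $ k)) * x i)"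

definition set_entry :: "nat ^ 'd \<Rightarrow> 'd \<Rightarrow> nat \<Rightarrow> nat ^ 'd" where
  "set_entry q k j = (\<chi> l. if l = k then j else q $ l)"

lemma finite_mi_le: "finite {i :: nat ^ 'd. i \<le> q \<and> P i}"
proof (rule finite_subset)
  show "{i. i \<le> q \<and> P i} \<subseteq> mi_upto (mi_deg q)"
    by (auto simp: mi_upto_def mi_deg_def less_eq_vec_def intro: sum_mono)
qed (rule finite_mi_upto)

lemma partial_shift_empty: "partial_shift t x {} q = x q"
proof -
  have "{i. i \<le> q \<and> (\<forall>k. i $ k = q $ k)} = {q}" by (auto simp: vec_eq_iff)
  then show ?thesis by (simp add: partial_shift_def)
qed

text \<open>
  The weights factor over the axes, so the shift along one more axis is a one-dimensional convolution.
\<close>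
lemma partial_shift_insert:
  assumes k: "k \<notin> D"
  shows "partial_shift t x (insert k D) q =
    (\<Sum>j\<le>q $ k. t k (q $ k - j) * partial_shift t x D (set_entry q k j))"
proof -
  let ?I = "\<lambda>D q. {i :: nat ^ 'a. i \<le> q \<and> (\<forall>l. l \<notin> D \<longrightarrow> i $ l = q $ l)}"
  have "(\<Sum>j\<le>q $ k. t k (q $ k - j) * partial_shift t x D (set_entry q k j)) =
    (\<Sum>j\<le>q $ k. \<Sum>i\<in>?I D (set_entry q k j).
       t k (q $ k - j) * ((\<Prod>l\<in>D. t l (set_entry q k j $ l - i $ l)) * x i))"
    by (simp add: partial_shift_def sum_distrib_left)
  also have "\<dots> = (\<Sum>(j, i)\<in>Sigma {..q $ k} (\<lambda>j. ?I D (set_entry q k j)).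
       t k (q $ k - j) * ((\<Prod>l\<in>D. t l (set_entry q k j $ l - i $ l)) * x i))"
    by (intro sum.Sigma) (auto simp: finite_mi_le)
  also have "\<dots> = (\<Sum>i\<in>?I (insert k D) q. (\<Prod>l\<in>insert k D. t l (q $ l - i $ l)) * x i)"
  proof (rule sum.reindex_bij_witness[where i = "\<lambda>i. (i $ k, i)" and j = snd])
    fix b assume b: "b \<in> ?I (insert k D) q"
    then show "(b $ k, b) \<in> Sigma {..q $ k} (\<lambda>j. ?I D (set_entry q k j))"
      by (auto simp: set_entry_def less_eq_vec_def)
  next
    fix z assume z: "z \<in> Sigma {..q $ k} (\<lambda>j. ?I D (set_entry q k j))"
    obtain j i where ji: "z = (j, i)" by (cases z)
    have j: "j \<le> q $ k" and i: "i \<le> set_entry q k j" "\<And>l. l \<notin> D \<Longrightarrow> i $ l = set_entry q k j $ l"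
      using z ji by auto
    have ik: "i $ k = j" using i(2)[OF k] by (simp add: set_entry_def)
    show "(snd z $ k, snd z) = z" using ji ik by simp
    have "i $ l \<le> q $ l" for l
    proof -
      have "i $ l \<le> set_entry q k j $ l" using i(1) by (simp add: less_eq_vec_def)
      then show ?thesis using j by (cases "l = k") (simp_all add: set_entry_def)
    qed
    then show "snd z \<in> ?I (insert k D) q"
      using ji i(2) by (auto simp: set_entry_def less_eq_vec_def)
    have "(\<Prod>l\<in>D. t l (set_entry q k j $ l - i $ l)) = (\<Prod>l\<in>D. t l (q $ l - i $ l))"
      using k by (intro prod.cong) (auto simp: set_entry_def)
    then show "(\<Prod>l\<in>insert k D. t l (q $ l - snd z $ l)) * x (snd z) =
      (case z of (j, i) \<Rightarrow> t k (q $ k - j) * ((\<Prod>l\<in>D. t l (set_entry q k j $ l - i $ l)) * x i))"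
      using ji ik k by (simp add: mult.assoc)
  qed auto
  finally show ?thesis by (simp add: partial_shift_def)
qed

text \<open>
  If all sources have the same \<open>k\<close>-th coordinate, then the convolution along axis \<open>k\<close> has one term.
  This is what removes the superfluous factor \<open>p\<close>.
\<close>
lemma partial_shift_slice:
  assumes "\<And>i. x i \<noteq> 0 \<Longrightarrow> i $ k = j"
  shows "partial_shift t x UNIV q =
    (if j \<le> q $ k then t k (q $ k - j) * partial_shift t x (UNIV - {k}) (set_entry q k j) else 0)"
proof -
  have off: "partial_shift t x (UNIV - {k}) (set_entry q k j') = 0" if "j' \<noteq> j" for j'
    unfolding partial_shift_def using assms that by (intro sum.neutral) (auto simp: set_entry_def)
  have "partial_shift t x UNIV q =
    (\<Sum>j'\<le>q $ k. t k (q $ k - j') * partial_shift t x (UNIV - {k}) (set_entry q k j'))"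
    using partial_shift_insert[of k "UNIV - {k}" t x q] by (simp add: insert_absorb)
  also have "\<dots> = (\<Sum>j'\<le>q $ k. if j' = j then t k (q $ k - j) * partial_shift t x (UNIV - {k}) (set_entry q k j) else 0)"
    by (intro sum.cong) (auto simp: off)
  finally show ?thesis by simp
qed

lemma partial_shift_sum:
  "partial_shift t (\<lambda>i. \<Sum>s\<in>S. x s i) D q = (\<Sum>s\<in>S. partial_shift t (x s) D q)"
  unfolding partial_shift_def sum_distrib_left by (rule sum.swap)

text \<open>
  Counting in the cube with side \<open>p\<close> instead of the simplex loses only a constant factor, and a slice
  of the cube is closed under lowering the other coordinates.
\<close>
definition slice :: "nat \<Rightarrow> 'd \<Rightarrow> nat \<Rightarrow> (nat ^ 'd) set" where
  "slice p k j = {q. (\<forall>l. q $ l \<le> p) \<and> q $ k = j}"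

lemma
  fixes k :: "'d::finite"
  shows finite_slice: "finite (slice p k j :: (nat ^ 'd) set)"
    and card_slice: "card (slice p k j :: (nat ^ 'd) set) \<le> (p + 1) ^ (CARD('d) - 1)"
proof -
  let ?F = "(UNIV - {k}) \<rightarrow>\<^sub>E {..p}"
  let ?g = "\<lambda>f. (\<chi> l. if l = k then j else f l) :: nat ^ 'd"
  have "slice p k j \<subseteq> ?g ` ?F"
  proof
    fix q :: "nat ^ 'd" assume "q \<in> slice p k j"
    then have "q = ?g (restrict (($) q) (UNIV - {k}))" "restrict (($) q) (UNIV - {k}) \<in> ?F"
      by (auto simp: vec_eq_iff slice_def)
    then show "q \<in> ?g ` ?F" by (rule image_eqI)
  qed
  moreover have fin: "finite ?F" by (simp add: finite_PiE)
  ultimately show "finite (slice p k j :: (nat ^ 'd) set)"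
    by (meson finite_imageI finite_subset)
  have "card (slice p k j :: (nat ^ 'd) set) \<le> card ?F"
    using \<open>slice p k j \<subseteq> ?g ` ?F\<close> fin by (meson card_image_le card_mono finite_imageI le_trans)
  also have "\<dots> = (p + 1) ^ (CARD('d) - 1)" by (simp add: card_PiE)
  finally show "card (slice p k j :: (nat ^ 'd) set) \<le> (p + 1) ^ (CARD('d) - 1)" .
qed

lemma mi_upto_entry_le: "q \<in> mi_upto p \<Longrightarrow> q $ k \<le> p"
  using member_le_sum[of k UNIV "\<lambda>k. q $ k"] by (simp add: mi_upto_def mi_deg_def)

lemma card_mi_upto: "card (mi_upto p :: (nat ^ 'd::finite) set) \<le> (p + 1) ^ CARD('d)"
proof -
  let ?F = "(UNIV :: 'd set) \<rightarrow>\<^sub>E {..p}"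
  have "mi_upto p \<subseteq> vec_lambda ` ?F"
  proof
    fix q :: "nat ^ 'd" assume q: "q \<in> mi_upto p"
    have "q = vec_lambda (($) q)" "($) q \<in> ?F" using mi_upto_entry_le[OF q] by auto
    then show "q \<in> vec_lambda ` ?F" by (rule image_eqI)
  qed
  moreover have fin: "finite ?F" by (simp add: finite_PiE)
  ultimately have "card (mi_upto p :: (nat ^ 'd) set) \<le> card ?F"
    by (meson card_image_le card_mono finite_imageI le_trans)
  then show ?thesis by (simp add: card_PiE)
qed

text \<open>
  On a slice, each axis of \<open>D\<close> costs at most \<open>p + 1\<close> multiplications and additions for each of
  \<open>(p + 1)\<^sup>d\<^sup>-\<^sup>1\<close> points, as the axis \<open>k\<close> is excluded.
\<close>
lemma derivable_partial_shift:
  fixes t :: "'d::finite \<Rightarrow> nat \<Rightarrow> 'e \<Rightarrow> complex" and x :: "nat ^ 'd \<Rightarrow> 'e \<Rightarrow> complex"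
  assumes V: "(\<lambda>_. 0) \<in> V" "\<And>k j. j \<le> p \<Longrightarrow> t k j \<in> V" "\<And>q. x q \<in> V" and D: "finite D" "k \<notin> D"
  shows "derivable V (card D * (2 * (p + 1) ^ CARD('d)))
    ((\<lambda>q e. partial_shift (\<lambda>k j. t k j e) (\<lambda>i. x i e) D q) ` slice p k j)"
  using D
proof (induction rule: finite_induct)
  case empty
  show ?case using V(3) by (intro derivable_refl) (auto simp: partial_shift_empty)
next
  case (insert l D)
  let ?y = "\<lambda>D q e. partial_shift (\<lambda>k j. t k j e) (\<lambda>i. x i e) D q"
  have "derivable (V \<union> ?y D ` slice p k j) (2 * (p + 1)) {?y (insert l D) q}"
    if q: "q \<in> slice p k j" for q
  proof -
    have "q $ l \<le> p" using q by (simp add: slice_def)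
    then have "set_entry q l i \<in> slice p k j" if "i \<le> q $ l" for i
      using q le_trans[OF that] insert.prems by (auto simp: slice_def set_entry_def)
    then have sum: "derivable (V \<union> ?y D ` slice p k j) (2 * card {..q $ l})
      {\<lambda>e. \<Sum>i\<le>q $ l. t l (q $ l - i) e * ?y D (set_entry q l i) e}"
      using V \<open>q $ l \<le> p\<close> by (intro derivable_sum_mult) auto
    show ?thesis
      by (rule derivable_mono[OF sum])
        (use \<open>q $ l \<le> p\<close> in \<open>auto simp: partial_shift_insert[OF insert.hyps(2)]\<close>)
  qed
  then have step: "derivable (V \<union> ?y D ` slice p k j) (card (slice p k j) * (2 * (p + 1)))
      (?y (insert l D) ` slice p k j)"
    by (intro derivable_each finite_slice)
  have "card (slice p k j) * (2 * (p + 1)) \<le> (p + 1) ^ (CARD('d) - 1) * (2 * (p + 1))"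
    by (intro mult_right_mono card_slice) simp
  also have "\<dots> = 2 * (p + 1) ^ CARD('d)"
    by (cases "CARD('d)") auto
  finally have "derivable (V \<union> ?y D ` slice p k j) (2 * (p + 1) ^ CARD('d)) (?y (insert l D) ` slice p k j)"
    by (intro derivable_mono[OF step]) auto
  from derivable_trans[OF insert.IH this] insert.prems show ?case
    using insert.hyps by (simp add: add.commute)
qed

text \<open>
  The data are distributed among the slices, the \<open>d - 1\<close> cheap shifts are done within each slice, and
  the results are combined by one term per slice and target.
\<close>
lemma derivable_shift_of_slices:
  fixes t :: "'d::finite \<Rightarrow> nat \<Rightarrow> 'e \<Rightarrow> complex" and x :: "nat ^ 'd \<Rightarrow> 'e \<Rightarrow> complex"
  assumes V: "(\<lambda>_. 0) \<in> V" "\<And>k j. j \<le> p \<Longrightarrow> t k j \<in> V" "\<And>q. x q \<in> V"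
    and supp: "\<And>q. x q \<noteq> (\<lambda>_. 0) \<Longrightarrow> \<exists>k. q $ k < m $ k"
  shows "derivable V (2 * mi_deg m * CARD('d) * (p + 1) ^ CARD('d))
    ((\<lambda>q e. partial_shift (\<lambda>k j. t k j e) (\<lambda>i. x i e) UNIV q) ` mi_upto p)"
proof -
  \<comment> \<open>A point on several slices must contribute once, so one of its axes is selected.\<close>
  define axis where "axis q = (SOME k. q $ k < m $ k)" for q
  have axis: "q $ axis q < m $ axis q" if "x q \<noteq> (\<lambda>_. 0)" for q
    unfolding axis_def using supp[OF that] by (rule someI_ex)
  define S where "S = Sigma UNIV (\<lambda>k. {..<m $ k})"
  have S: "finite S" "card S = mi_deg m" by (simp_all add: S_def mi_deg_def)
  define part where "part s q = (if s = (axis q, q $ axis q) then x q else (\<lambda>_. 0))" for s q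
  have part_V: "part s q \<in> V" for s q using V by (simp add: part_def)
  have x_eq: "x q e = (\<Sum>s\<in>S. part s q e)" for q e
  proof (cases "x q = (\<lambda>_. 0)")
    case True
    then have "part s q e = 0" for s by (simp add: part_def)
    then show ?thesis using True by simp
  next
    case False
    then have "(axis q, q $ axis q) \<in> S" using axis by (simp add: S_def)
    moreover have "(\<Sum>s\<in>S. part s q e) = (\<Sum>s\<in>S. if s = (axis q, q $ axis q) then x q e else 0)"
      by (intro sum.cong) (auto simp: part_def)
    ultimately show ?thesis using S(1) by simp
  qed
  let ?y = "\<lambda>s q e. partial_shift (\<lambda>k j. t k j e) (\<lambda>i. part s i e) (UNIV - {fst s}) q"
  let ?Y = "\<Union>s\<in>S. ?y s ` slice p (fst s) (snd s)"
  let ?z = "\<lambda>q e. partial_shift (\<lambda>k j. t k j e) (\<lambda>i. x i e) UNIV q"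
  have "derivable V (card S * ((CARD('d) - 1) * (2 * (p + 1) ^ CARD('d)))) ?Y"
  proof (rule derivable_UN[OF S(1)])
    fix s
    have "derivable V (card (UNIV - {fst s}) * (2 * (p + 1) ^ CARD('d))) (?y s ` slice p (fst s) (snd s))"
      by (rule derivable_partial_shift) (use V part_V in auto)
    then show "derivable V ((CARD('d) - 1) * (2 * (p + 1) ^ CARD('d))) (?y s ` slice p (fst s) (snd s))"
      by simp
  qed
  then have Y: "derivable V (mi_deg m * ((CARD('d) - 1) * (2 * (p + 1) ^ CARD('d)))) ?Y"
    by (simp only: S(2))
  have z_eq: "?z q e = (\<Sum>s\<in>{s \<in> S. snd s \<le> q $ fst s}.
      t (fst s) (q $ fst s - snd s) e * ?y s (set_entry q (fst s) (snd s)) e)" for q e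
  proof -
    have "?z q e = (\<Sum>s\<in>S. partial_shift (\<lambda>k j. t k j e) (\<lambda>i. part s i e) UNIV q)"
      by (simp add: x_eq partial_shift_sum)
    also have "\<dots> = (\<Sum>s\<in>S. if snd s \<le> q $ fst s
        then t (fst s) (q $ fst s - snd s) e * ?y s (set_entry q (fst s) (snd s)) e else 0)"
      by (intro sum.cong refl partial_shift_slice) (auto simp: part_def split: if_splits)
    finally show ?thesis using S(1) by (simp add: sum.inter_filter)
  qed
  have "derivable (V \<union> ?Y) (2 * mi_deg m) {?z q}" if q: "q \<in> mi_upto p" for q
  proof -
    have qp: "q $ k \<le> p" for k by (rule mi_upto_entry_le[OF q])
    let ?S = "{s \<in> S. snd s \<le> q $ fst s}"
    have sum: "derivable (V \<union> ?Y) (2 * card ?S)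
        {\<lambda>e. \<Sum>s\<in>?S. t (fst s) (q $ fst s - snd s) e * ?y s (set_entry q (fst s) (snd s)) e}"
    proof (rule derivable_sum_mult)
      fix s assume s: "s \<in> ?S"
      have "q $ fst s - snd s \<le> p" using qp[of "fst s"] by simp
      then show "t (fst s) (q $ fst s - snd s) \<in> V \<union> ?Y" using V by simp
      have "set_entry q (fst s) (snd s) \<in> slice p (fst s) (snd s)"
        using s qp le_trans[OF _ qp[of "fst s"], of "snd s"] by (auto simp: slice_def set_entry_def)
      then show "?y s (set_entry q (fst s) (snd s)) \<in> V \<union> ?Y" using s by blast
    qed (use S V in auto)
    have "card ?S \<le> card S" by (rule card_mono) (use S in auto)
    then show ?thesis
      by (intro derivable_mono[OF sum]) (auto simp: z_eq S)
  qed
  from derivable_each[OF finite_mi_upto this]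
  have "derivable (V \<union> ?Y) (card (mi_upto p :: (nat ^ 'd) set) * (2 * mi_deg m)) (?z ` mi_upto p)" .
  then have "derivable (V \<union> ?Y) ((p + 1) ^ CARD('d) * (2 * mi_deg m)) (?z ` mi_upto p)"
    by (rule derivable_mono) (use card_mi_upto[where 'd = 'd, of p] in auto)
  from derivable_trans[OF Y this]
  have "derivable V (mi_deg m * ((CARD('d) - 1) * (2 * (p + 1) ^ CARD('d))) +
      (p + 1) ^ CARD('d) * (2 * mi_deg m)) (?z ` mi_upto p)" .
  also have "mi_deg m * ((CARD('d) - 1) * (2 * (p + 1) ^ CARD('d))) + (p + 1) ^ CARD('d) * (2 * mi_deg m) =
      2 * mi_deg m * CARD('d) * (p + 1) ^ CARD('d)"
    by (cases "CARD('d)") (auto simp: algebra_simps)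
  finally show ?thesis .
qed

section \<open>The translation as a shift\<close>

definition taylor_weight :: "real ^ 'd \<Rightarrow> 'd \<Rightarrow> nat \<Rightarrow> complex" where
  "taylor_weight h k j = of_real (h $ k ^ j / fact j)"

lemma shifted_coeff_eq_partial_shift:
  fixes a :: "nat ^ 'd \<Rightarrow> complex"
  assumes \<nu>: "graded_monomial_ordering \<nu>" and q: "q \<in> mi_upto p"
  shows "shifted_coeff a c \<nu> p h \<beta> (mi_rank \<nu> q) =
    partial_shift (taylor_weight h) (\<lambda>n. embed_stored a c \<nu> p \<beta> (mi_rank \<nu> n)) UNIV q"
  unfolding shifted_coeff_def partial_shift_def
proof (rule sum.reindex_bij_witness[where i = "mi_rank \<nu>" and j = \<nu>])
  fix i assume i: "i \<in> {i. i \<in> {1..mi_count TYPE('d) p} \<and> \<nu> i \<le> \<nu> (mi_rank \<nu> q)}"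
  show "mi_rank \<nu> (\<nu> i) = i" using i mi_rank(3)[OF \<nu>] by simp
  show "\<nu> i \<in> {i. i \<le> q \<and> (\<forall>k. k \<notin> UNIV \<longrightarrow> i $ k = q $ k)}" using i mi_rank(2)[OF \<nu>] by simp
  have "(\<Prod>k\<in>UNIV. taylor_weight h k (q $ k - \<nu> i $ k)) =
      of_real (mi_power h (q - \<nu> i) / real (mi_fact (q - \<nu> i)))"
    by (simp add: taylor_weight_def mi_power_def mi_fact_def prod_dividef)
  then show "(\<Prod>k\<in>UNIV. taylor_weight h k (q $ k - \<nu> i $ k)) *
      embed_stored a c \<nu> p \<beta> (mi_rank \<nu> (\<nu> i)) =
    of_real (mi_power h (\<nu> (mi_rank \<nu> q) - \<nu> i) / real (mi_fact (\<nu> (mi_rank \<nu> q) - \<nu> i))) *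
      embed_stored a c \<nu> p \<beta> i"
    using i mi_rank(2,3)[OF \<nu>] by simp
next
  fix n assume "n \<in> {i. i \<le> q \<and> (\<forall>k. k \<notin> UNIV \<longrightarrow> i $ k = q $ k)}"
  then have n: "n \<le> q" by simp
  show "\<nu> (mi_rank \<nu> n) = n" using mi_rank(2)[OF \<nu>] .
  have "mi_deg n \<le> mi_deg q" using n by (auto simp: mi_deg_def less_eq_vec_def intro: sum_mono)
  then have "n \<in> mi_upto p" using q by (simp add: mi_upto_def)
  then have "mi_rank \<nu> n \<in> {1..mi_count TYPE('d) p}" using mi_rank_image[OF \<nu>] by blast
  then show "mi_rank \<nu> n \<in> {i. i \<in> {1..mi_count TYPE('d) p} \<and> \<nu> i \<le> \<nu> (mi_rank \<nu> q)}"
    using n mi_rank(2)[OF \<nu>] by simp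
qed

text \<open>
  The weights come from \<open>h\<^sup>j\<^sup>+\<^sup>1 / (j + 1)! = (h\<^sup>j / j!) h / (j + 1)\<close>, and the
  divisors \<open>j + 1\<close> are obtained by counting upwards.
\<close>
lemma derivable_taylor_weights:
  fixes h :: "'e \<Rightarrow> real ^ 'd"
  assumes "(\<lambda>_. 0) \<in> V" "(\<lambda>_. 1) \<in> V" "\<And>k. (\<lambda>e. of_real (h e $ k)) \<in> V"
  shows "derivable V ((p + 1) * (2 * CARD('d) + 1)) (\<Union>k. (\<lambda>j e. taylor_weight (h e) k j) ` {..p})"
proof -
  let ?N = "(\<lambda>j e. of_nat j) ` {..p} :: ('e \<Rightarrow> complex) set"
  have "derivable V (card {..p} * 1) ?N"
  proof (rule derivable_family[where r = id])
    fix j assume j: "j \<in> {..p}"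
    show "derivable (V \<union> (\<lambda>j e. of_nat j) ` {i \<in> {..p}. id i < id j}) 1 {\<lambda>e. of_nat j :: complex}"
    proof (cases j)
      case 0
      then show ?thesis using assms by (intro derivable_refl) simp
    next
      case (Suc i)
      show ?thesis
        by (rule derivable_op[where f = Add and x = "\<lambda>e. of_nat i" and y = "\<lambda>_. 1"])
          (use assms j Suc in auto)
    qed
  qed simp
  then have N: "derivable V (p + 1) ?N" by simp
  let ?t = "\<lambda>k j e. taylor_weight (h e) k j"
  have "derivable (V \<union> ?N) (card {..p} * 2) (?t k ` {..p})" for k
  proof (rule derivable_family[where r = id])
    fix j assume j: "j \<in> {..p}"
    let ?V = "V \<union> ?N \<union> ?t k ` {i \<in> {..p}. id i < id j}"
    show "derivable ?V 2 {?t k j}"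
    proof (cases j)
      case 0
      then show ?thesis using assms by (intro derivable_refl) (simp add: taylor_weight_def)
    next
      case (Suc i)
      let ?m = "\<lambda>e. ?t k i e * of_real (h e $ k)"
      have m: "derivable ?V 1 {?m}"
        by (rule derivable_op[where f = Mul and x = "?t k i" and y = "\<lambda>e. of_real (h e $ k)"])
          (use assms j Suc in auto)
      have "derivable (?V \<union> {?m}) 1 {?t k j}"
      proof (rule derivable_op[where f = Div and x = ?m and y = "\<lambda>e. of_nat j"])
        show "apply_op Div (?m e) (of_nat j) = Some (?t k j e)" for e
          using Suc by (simp add: taylor_weight_def field_simps del: of_nat_Suc)
      qed (use j in auto)
      from derivable_trans[OF m this] show ?thesis by (simp only: one_add_one)
    qed
  qed simp
  then have "derivable (V \<union> ?N) (CARD('d) * (card {..p} * 2)) (\<Union>k. ?t k ` {..p})"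
    by (intro derivable_UN) auto
  from derivable_trans[OF N this] show ?thesis by (simp add: algebra_simps)
qed

section \<open>Compression by back substitution\<close>

lemma mi_deg_add: "mi_deg (m + n) = mi_deg m + mi_deg n"
  by (simp add: mi_deg_def sum.distrib)

lemma mi_rank_deg_mono:
  assumes \<nu>: "graded_monomial_ordering \<nu>" and "mi_rank \<nu> m \<le> mi_rank \<nu> n"
  shows "mi_deg m \<le> mi_deg n"
proof (rule ccontr)
  assume "\<not> mi_deg m \<le> mi_deg n"
  then have "mi_deg (\<nu> (mi_rank \<nu> n)) < mi_deg (\<nu> (mi_rank \<nu> m))" by (simp add: mi_rank(2)[OF \<nu>])
  then have "mi_rank \<nu> n < mi_rank \<nu> m"
    using \<nu> mi_rank(1)[OF \<nu>] by (simp add: graded_monomial_ordering_def)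
  then show False using assms(2) by simp
qed

text \<open>
  Adding a fixed multi-index preserves the ordering, so in every row the last nonzero column is the one
  displaced by \<open>m\<close>. This gives the slices that contain the stored indices, as well as the triangular
  shape of the eliminated block.
\<close>
lemma leading_exponent:
  fixes a :: "nat ^ 'd \<Rightarrow> complex"
  assumes \<nu>: "graded_monomial_ordering \<nu>" and a: "\<exists>m. mi_deg m = c \<and> a m \<noteq> 0" and "c \<le> p"
  obtains m where "mi_deg m = c" "\<And>l. l \<in> stored_idx a c \<nu> p \<Longrightarrow> \<exists>k. \<nu> l $ k < m $ k"
    "\<And>i. i \<in> {1..mi_count TYPE('d) (p - c)} \<Longrightarrow> pde_mat a c \<nu> i (last_col a c \<nu> p i) \<noteq> 0"
    "\<And>i k. i \<in> {1..mi_count TYPE('d) (p - c)} \<Longrightarrow> k \<in> {1..mi_count TYPE('d) (p - c)} \<Longrightarrow>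
      pde_mat a c \<nu> k (last_col a c \<nu> p i) \<noteq> 0 \<Longrightarrow> i \<le> k"
proof -
  let ?R = "{1..mi_count TYPE('d) (p - c)}" and ?g = "last_col a c \<nu> p"
  obtain m where m: "mi_deg m \<le> c" "a m \<noteq> 0"
    "\<And>i. i \<in> ?R \<Longrightarrow> ?g i = mi_rank \<nu> (\<nu> i + m)"
    "\<And>i k. 1 \<le> i \<Longrightarrow> 1 \<le> k \<Longrightarrow> pde_mat a c \<nu> i k \<noteq> 0 \<Longrightarrow> k \<le> mi_rank \<nu> (\<nu> i + m)"
    using last_col_eq[OF \<nu> a \<open>c \<le> p\<close>] by metis
  obtain n where n: "mi_deg n = c" "a n \<noteq> 0" using a by blast
  have nu1: "\<nu> 1 = 0" using \<nu> by (simp add: graded_monomial_ordering_def)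
  \<comment> \<open>Row 1 belongs to the multi-index 0, so its nonzero columns are the exponents of the operator. One of
    them has degree \<open>c\<close>, hence so has the last one.\<close>
  have "pde_mat a c \<nu> 1 (mi_rank \<nu> n) \<noteq> 0"
    using n nu1 by (simp add: pde_mat_def mi_rank(2)[OF \<nu>] mi_upto_def less_eq_vec_def)
  then have "mi_rank \<nu> n \<le> mi_rank \<nu> (\<nu> 1 + m)" by (rule m(4)[OF order_refl mi_rank(1)[OF \<nu>]])
  then have "mi_rank \<nu> n \<le> mi_rank \<nu> m" by (simp only: nu1 add_0)
  then have deg: "mi_deg m = c" using mi_rank_deg_mono[OF \<nu>] n(1) m(1) by (metis le_antisym)
  have stored: "\<exists>k. \<nu> l $ k < m $ k" if l: "l \<in> stored_idx a c \<nu> p" for l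
  proof (rule ccontr)
    assume "\<not> (\<exists>k. \<nu> l $ k < m $ k)"
    then have eq: "\<nu> l = (\<nu> l - m) + m" by (simp add: vec_eq_iff not_less)
    have l1: "l \<in> {1..mi_count TYPE('d) p}" using l by (simp add: stored_idx_def)
    then have "l \<in> mi_rank \<nu> ` mi_upto p" using mi_rank_image[OF \<nu>] by blast
    then have "mi_deg (\<nu> l) \<le> p" using mi_rank(2)[OF \<nu>] by (auto simp: mi_upto_def)
    moreover have "mi_deg (\<nu> l) = mi_deg (\<nu> l - m) + mi_deg m"
      by (subst eq) (rule mi_deg_add)
    ultimately have "\<nu> l - m \<in> mi_upto (p - c)" using deg by (simp add: mi_upto_def)
    then have i: "mi_rank \<nu> (\<nu> l - m) \<in> ?R" using mi_rank_image[OF \<nu>] by blast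
    have "?g (mi_rank \<nu> (\<nu> l - m)) = mi_rank \<nu> (\<nu> l)"
      using m(3)[OF i] eq by (simp add: mi_rank(2)[OF \<nu>])
    then have "?g (mi_rank \<nu> (\<nu> l - m)) = l" using l1 mi_rank(3)[OF \<nu>] by simp
    then have "l \<in> elim_idx a c \<nu> p" using i unfolding elim_idx_def by (metis imageI)
    then show False using l by (simp add: stored_idx_def)
  qed
  have diag: "pde_mat a c \<nu> i (?g i) \<noteq> 0" if i: "i \<in> ?R" for i
  proof -
    have "\<nu> i + m - \<nu> i = m" by (simp add: vec_eq_iff)
    then show ?thesis
      using m(1,2) m(3)[OF i] by (simp add: pde_mat_def mi_rank(2)[OF \<nu>] less_eq_vec_def mi_upto_def)
  qed
  have tri: "i \<le> k" if ik: "i \<in> ?R" "k \<in> ?R" "pde_mat a c \<nu> k (?g i) \<noteq> 0" for i k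
  proof (rule ccontr)
    assume "\<not> i \<le> k"
    then have "mi_rank \<nu> (\<nu> k + \<nu> (mi_rank \<nu> m)) < mi_rank \<nu> (\<nu> i + \<nu> (mi_rank \<nu> m))"
      using \<nu> ik mi_rank(1)[OF \<nu>, of m] by (simp add: graded_monomial_ordering_def)
    then have "mi_rank \<nu> (\<nu> k + m) < ?g i" using ik m(3) by (simp add: mi_rank(2)[OF \<nu>])
    moreover have "?g i \<le> mi_rank \<nu> (\<nu> k + m)"
      using ik m(3) mi_rank(1)[OF \<nu>] by (intro m(4)) auto
    ultimately show False by simp
  qed
  show thesis using that[OF deg stored diag tri] .
qed

text \<open>
  A nonzero entry in column \<open>k\<close> is determined by its exponent \<open>\<nu> k - \<nu> i\<close>, for which there are at most
  \<open>N(c)\<close> choices.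
\<close>
lemma card_pde_mat_column:
  fixes a :: "nat ^ 'd \<Rightarrow> complex"
  assumes \<nu>: "graded_monomial_ordering \<nu>"
  shows "card {i \<in> {1..n}. pde_mat a c \<nu> i k \<noteq> 0} \<le> card (mi_upto c :: (nat ^ 'd) set)"
proof (rule card_inj_on_le[where f = "\<lambda>i. \<nu> k - \<nu> i"])
  show "inj_on (\<lambda>i. \<nu> k - \<nu> i) {i \<in> {1..n}. pde_mat a c \<nu> i k \<noteq> 0}"
  proof (rule inj_onI)
    fix i j assume i: "i \<in> {i \<in> {1..n}. pde_mat a c \<nu> i k \<noteq> 0}"
      and j: "j \<in> {i \<in> {1..n}. pde_mat a c \<nu> i k \<noteq> 0}" and eq: "\<nu> k - \<nu> i = \<nu> k - \<nu> j"
    have le: "\<nu> i \<le> \<nu> k" "\<nu> j \<le> \<nu> k" using i j by (auto simp: pde_mat_def split: if_splits)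
    have "\<nu> i $ l = \<nu> j $ l" for l
    proof -
      have "\<nu> i $ l \<le> \<nu> k $ l" "\<nu> j $ l \<le> \<nu> k $ l" using le by (simp_all add: less_eq_vec_def)
      moreover have "\<nu> k $ l - \<nu> i $ l = \<nu> k $ l - \<nu> j $ l"
        using arg_cong[OF eq, of "\<lambda>v. v $ l"] by simp
      ultimately show ?thesis by linarith
    qed
    then have "\<nu> i = \<nu> j" by (simp add: vec_eq_iff)
    then show "i = j" using i j mi_rank(3)[OF \<nu>] by (metis (no_types, lifting) atLeastAtMost_iff mem_Collect_eq)
  qed
qed (auto simp: finite_mi_upto pde_mat_def split: if_splits)

text \<open>
  Equation \<open>i\<close> contains only unknowns \<open>w k\<close> with \<open>k \<ge> i\<close>, so the unknowns are found from the last one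
  downwards, with one multiplication and one addition for each later unknown that occurs, one subtraction
  and one division.
\<close>
lemma derivable_triangular_solve:
  fixes w :: "nat \<Rightarrow> 'e \<Rightarrow> complex"
  assumes V: "(\<lambda>_. 0) \<in> V" "\<And>i k. (\<lambda>_. A i k) \<in> V" "\<And>i. i \<in> {1..n} \<Longrightarrow> \<sigma> (g i) \<in> V"
    and diag: "\<And>i. i \<in> {1..n} \<Longrightarrow> A i (g i) \<noteq> 0"
    and tri: "\<And>i k. i \<in> {1..n} \<Longrightarrow> k \<in> {1..n} \<Longrightarrow> A k (g i) \<noteq> 0 \<Longrightarrow> i \<le> k"
    and sparse: "\<And>k. card {i \<in> {1..n}. A i k \<noteq> 0} \<le> C"
    and eq: "\<And>i e. i \<in> {1..n} \<Longrightarrow> (\<Sum>k\<in>{1..n}. A k (g i) * w k e) = \<sigma> (g i) e"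
  shows "derivable V (n * (2 * C + 2)) (w ` {1..n})"
proof -
  have "derivable V (card {1..n} * (2 * C + 2)) (w ` {1..n})"
  proof (rule derivable_family[where r = "\<lambda>i. n - i"])
    fix i assume i: "i \<in> {1..n}"
    let ?V = "V \<union> w ` {k \<in> {1..n}. n - k < n - i}"
    let ?K = "{k \<in> {1..n}. A k (g i) \<noteq> 0} - {i}"
    let ?s = "\<lambda>e. \<Sum>k\<in>?K. A k (g i) * w k e"
    have sum: "derivable ?V (2 * card ?K) {?s}"
    proof (rule derivable_sum_mult)
      fix k assume k: "k \<in> ?K"
      then have "i \<le> k" "k \<noteq> i" using tri[OF i] by auto
      then have "n - k < n - i" using k by auto
      then show "w k \<in> ?V" using k by blast
    qed (use V in auto)
    have "card ?K \<le> C"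
      using sparse[of "g i"] card_Diff1_le[of "{k \<in> {1..n}. A k (g i) \<noteq> 0}" i] by linarith
    then have s: "derivable ?V (2 * C) {?s}" by (intro derivable_mono[OF sum]) auto
    let ?d = "\<lambda>e. \<sigma> (g i) e - ?s e"
    have d: "derivable (?V \<union> {?s}) 1 {?d}"
      by (rule derivable_op[where f = Sub and x = "\<sigma> (g i)" and y = ?s]) (use V i in auto)
    have split: "\<sigma> (g i) e = A i (g i) * w i e + ?s e" for e
    proof -
      have "\<sigma> (g i) e = (\<Sum>k\<in>{k \<in> {1..n}. A k (g i) \<noteq> 0}. A k (g i) * w k e)"
        unfolding eq[OF i, symmetric] by (rule sum.mono_neutral_right) auto
      then show ?thesis
        using i diag by (subst (asm) sum.remove[of _ i]) auto
    qed
    have "derivable (?V \<union> {?s} \<union> {?d}) 1 {w i}"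
      by (rule derivable_op[where f = Div and x = ?d and y = "\<lambda>_. A i (g i)"])
        (use V i diag split in auto)
    from derivable_trans[OF s derivable_trans[OF d this]]
    show "derivable ?V (2 * C + 2) {w i}" by (simp only: one_add_one)
  qed simp
  then show ?thesis by simp
qed

lemma inverse_mat_transpose_solve:
  assumes "is_inverse_mat R S A B" "t \<in> S" "finite S"
  shows "(\<Sum>i\<in>R. A i t * (\<Sum>s\<in>S. B s i * \<sigma> s)) = \<sigma> t"
proof -
  have "(\<Sum>i\<in>R. A i t * (\<Sum>s\<in>S. B s i * \<sigma> s)) = (\<Sum>s\<in>S. (\<Sum>i\<in>R. B s i * A i t) * \<sigma> s)"
    unfolding sum_distrib_left sum_distrib_right by (subst sum.swap) (simp add: mult_ac)
  also have "\<dots> = (\<Sum>s\<in>S. if s = t then \<sigma> s else 0)"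
    by (intro sum.cong) (use assms in \<open>auto simp: is_inverse_mat_def\<close>)
  finally show ?thesis using assms by simp
qed

lemma elim_idx_subset:
  fixes a :: "nat ^ 'd \<Rightarrow> complex"
  assumes \<nu>: "graded_monomial_ordering \<nu>" and a: "\<exists>m. mi_deg m = c \<and> a m \<noteq> 0" and "c \<le> p"
  shows "elim_idx a c \<nu> p \<subseteq> {1..mi_count TYPE('d) p}"
proof -
  obtain m where m: "mi_deg m \<le> c"
    "\<And>i. i \<in> {1..mi_count TYPE('d) (p - c)} \<Longrightarrow> last_col a c \<nu> p i = mi_rank \<nu> (\<nu> i + m)"
    using last_col_eq[OF assms] by metis
  have "last_col a c \<nu> p i \<in> {1..mi_count TYPE('d) p}" if i: "i \<in> {1..mi_count TYPE('d) (p - c)}" for i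
  proof -
    have "i \<in> mi_rank \<nu> ` mi_upto (p - c)" using i mi_rank_image[OF \<nu>] by blast
    then have "mi_deg (\<nu> i) \<le> p - c" using mi_rank(2)[OF \<nu>] by (auto simp: mi_upto_def)
    then have "\<nu> i + m \<in> mi_upto p" using m(1) \<open>c \<le> p\<close> by (simp add: mi_upto_def mi_deg_add)
    then show ?thesis unfolding m(2)[OF i] using mi_rank_image[OF \<nu>] by blast
  qed
  then show ?thesis by (auto simp: elim_idx_def)
qed

text \<open>
  Regrouping the product with the decompression matrix turns the multiplication by the full inverse into
  the vector \<open>w\<^sub>i = \<Sum>q. (P\<^sup>-\<^sup>1)\<^sub>q\<^sub>i \<sigma>\<^sub>q\<close>, which solves a sparse triangular system.
\<close>
lemma translated_coeff_eq:
  fixes a :: "nat ^ 'd \<Rightarrow> complex"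
  assumes ord: "graded_monomial_ordering \<nu>" "\<exists>m. mi_deg m = c \<and> a m \<noteq> 0" "c \<le> p"
    and l: "l \<in> stored_idx a c \<nu> p"
  shows "translated_coeff a c \<nu> p c1 c2 \<beta> l = shifted_coeff a c \<nu> p (c2 - c1) \<beta> l -
    (\<Sum>i\<in>{1..mi_count TYPE('d) (p - c)}. pde_mat a c \<nu> i l *
      (\<Sum>q\<in>elim_idx a c \<nu> p. elim_inv a c \<nu> p q i * shifted_coeff a c \<nu> p (c2 - c1) \<beta> q))"
proof -
  let ?I = "{1..mi_count TYPE('d) p}" and ?E = "elim_idx a c \<nu> p" and ?R = "{1..mi_count TYPE('d) (p - c)}"
  let ?\<sigma> = "shifted_coeff a c \<nu> p (c2 - c1) \<beta>"
  have E: "?E \<subseteq> ?I" "finite ?E" using elim_idx_subset[OF ord] by (auto simp: elim_idx_def)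
  have lI: "l \<in> ?I - ?E" using l by (simp add: stored_idx_def)
  have "translated_coeff a c \<nu> p c1 c2 \<beta> l =
      (\<Sum>q\<in>?I - ?E. decompression_mat a c \<nu> p q l * ?\<sigma> q) + (\<Sum>q\<in>?E. decompression_mat a c \<nu> p q l * ?\<sigma> q)"
    unfolding translated_coeff_def by (rule sum.subset_diff[OF E(1)]) simp
  also have "(\<Sum>q\<in>?I - ?E. decompression_mat a c \<nu> p q l * ?\<sigma> q) = (\<Sum>q\<in>?I - ?E. if q = l then ?\<sigma> q else 0)"
    by (intro sum.cong) (auto simp: decompression_mat_def)
  also have "\<dots> = ?\<sigma> l" using lI by simp
  also have "(\<Sum>q\<in>?E. decompression_mat a c \<nu> p q l * ?\<sigma> q) =
      - (\<Sum>q\<in>?E. \<Sum>i\<in>?R. pde_mat a c \<nu> i l * (elim_inv a c \<nu> p q i * ?\<sigma> q))"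
    by (simp add: decompression_mat_def sum_distrib_left sum_negf mult_ac)
  also have "(\<Sum>q\<in>?E. \<Sum>i\<in>?R. pde_mat a c \<nu> i l * (elim_inv a c \<nu> p q i * ?\<sigma> q)) =
      (\<Sum>i\<in>?R. pde_mat a c \<nu> i l * (\<Sum>q\<in>?E. elim_inv a c \<nu> p q i * ?\<sigma> q))"
    unfolding sum_distrib_left by (rule sum.swap)
  finally show ?thesis by simp
qed

lemma derivable_compress:
  fixes a :: "nat ^ 'd \<Rightarrow> complex" and \<sigma> \<psi> :: "nat \<Rightarrow> 'e \<Rightarrow> complex"
  assumes ord: "graded_monomial_ordering \<nu>" "\<exists>m. mi_deg m = c \<and> a m \<noteq> 0" "c \<le> p"
    and V: "(\<lambda>_. 0) \<in> V" "\<And>m. m \<in> mi_upto c \<Longrightarrow> (\<lambda>_. a m) \<in> V"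
      "\<And>q. q \<in> {1..mi_count TYPE('d) p} \<Longrightarrow> \<sigma> q \<in> V"
    and \<psi>: "\<And>l e. l \<in> stored_idx a c \<nu> p \<Longrightarrow> \<psi> l e = \<sigma> l e -
      (\<Sum>i\<in>{1..mi_count TYPE('d) (p - c)}. pde_mat a c \<nu> i l *
        (\<Sum>q\<in>elim_idx a c \<nu> p. elim_inv a c \<nu> p q i * \<sigma> q e))"
  shows "derivable V (mi_count TYPE('d) p * (4 * mi_count TYPE('d) c + 3)) (\<psi> ` stored_idx a c \<nu> p)"
proof -
  let ?n = "mi_count TYPE('d) (p - c)" and ?N = "mi_count TYPE('d) p" and ?C = "mi_count TYPE('d) c"
  let ?A = "pde_mat a c \<nu>" and ?g = "last_col a c \<nu> p" and ?E = "elim_idx a c \<nu> p"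
  have nN: "?n \<le> ?N" unfolding mi_count_def
    by (rule card_mono[OF finite_mi_upto]) (auto simp: mi_upto_def)
  have E: "?E \<subseteq> {1..?N}" "finite ?E" using elim_idx_subset[OF ord] by (auto simp: elim_idx_def)
  have gE: "?g i \<in> ?E" if "i \<in> {1..?n}" for i using that by (simp add: elim_idx_def)
  have AV: "(\<lambda>_. ?A i k) \<in> V" for i k using V by (simp add: pde_mat_def)
  have sparse: "card {i \<in> {1..?n}. ?A i k \<noteq> 0} \<le> ?C" for k
    unfolding mi_count_def by (rule card_pde_mat_column[OF ord(1)])
  define w where "w i e = (\<Sum>q\<in>?E. elim_inv a c \<nu> p q i * \<sigma> q e)" for i e
  obtain m where diag: "\<And>i. i \<in> {1..?n} \<Longrightarrow> ?A i (?g i) \<noteq> 0"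
    and tri: "\<And>i k. i \<in> {1..?n} \<Longrightarrow> k \<in> {1..?n} \<Longrightarrow> ?A k (?g i) \<noteq> 0 \<Longrightarrow> i \<le> k"
    using leading_exponent[OF ord] by metis
  have "derivable V (?n * (2 * ?C + 2)) (w ` {1..?n})"
  proof (rule derivable_triangular_solve[where A = ?A and g = ?g and \<sigma> = \<sigma>])
    fix i e assume "i \<in> {1..?n}"
    then show "(\<Sum>k\<in>{1..?n}. ?A k (?g i) * w k e) = \<sigma> (?g i) e"
      unfolding w_def using gE E by (intro inverse_mat_transpose_solve is_inverse_mat_elim_inv ord)
  next
    fix i assume "i \<in> {1..?n}"
    then show "\<sigma> (?g i) \<in> V" by (rule V(3)[OF subsetD[OF E(1) gE]])
  qed (fact V(1) AV diag tri sparse)+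
  then have W: "derivable V (?N * (2 * ?C + 2)) (w ` {1..?n})"
    by (rule derivable_mono) (simp_all only: mult_le_mono1[OF nN] subset_refl)
  have psi: "derivable (V \<union> w ` {1..?n}) (2 * ?C + 1) {\<psi> l}" if l: "l \<in> stored_idx a c \<nu> p" for l
  proof -
    let ?K = "{i \<in> {1..?n}. ?A i l \<noteq> 0}"
    let ?s = "\<lambda>e. \<Sum>i\<in>?K. ?A i l * w i e"
    have "derivable (V \<union> w ` {1..?n}) (2 * card ?K) {?s}"
      by (rule derivable_sum_mult) (use V AV in auto)
    then have s: "derivable (V \<union> w ` {1..?n}) (2 * ?C) {?s}"
      by (rule derivable_mono) (use sparse in auto)
    have "?s e = (\<Sum>i\<in>{1..?n}. ?A i l * w i e)" for e
      by (rule sum.mono_neutral_left) auto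
    then have "\<psi> l e = \<sigma> l e - ?s e" for e by (simp add: \<psi>[OF l] w_def)
    then have "derivable (V \<union> w ` {1..?n} \<union> {?s}) 1 {\<psi> l}"
      by (intro derivable_op[where f = Sub and x = "\<sigma> l" and y = ?s])
        (use V(3) l in \<open>auto simp: stored_idx_def\<close>)
    from derivable_trans[OF s this] show ?thesis .
  qed
  have stored: "card (stored_idx a c \<nu> p) \<le> ?N"
    using card_mono[of "{1..?N}" "stored_idx a c \<nu> p"] by (auto simp: stored_idx_def)
  have "derivable (V \<union> w ` {1..?n}) (card (stored_idx a c \<nu> p) * (2 * ?C + 1)) (\<psi> ` stored_idx a c \<nu> p)"
    by (rule derivable_each) (use psi in \<open>auto simp: stored_idx_def\<close>)
  then have "derivable (V \<union> w ` {1..?n}) (?N * (2 * ?C + 1)) (\<psi> ` stored_idx a c \<nu> p)"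
    by (rule derivable_mono) (simp_all only: mult_le_mono1[OF stored] subset_refl)
  from derivable_trans[OF W this] show ?thesis by (simp add: algebra_simps)
qed

section \<open>The translation program\<close>

lemma translation_program:
  fixes a :: "nat ^ 'd \<Rightarrow> complex"
  assumes ord: "graded_monomial_ordering \<nu>" "\<exists>m. mi_deg m = c \<and> a m \<noteq> 0" "c \<le> p"
  shows "\<exists>P out. length P \<le> (3 * CARD('d) + 2 * c * CARD('d) + 4 * mi_count TYPE('d) c + 4)
      * (p + 1) ^ CARD('d) \<and>
    (\<forall>c1 c2 \<beta>. computes_on (translation_input a c \<nu> p c1 c2 \<beta>) P out
      (stored_idx a c \<nu> p) (translated_coeff a c \<nu> p c1 c2 \<beta>))"
proof -
  let ?d = "CARD('d)" and ?C = "mi_count TYPE('d) c" and ?N = "mi_count TYPE('d) p"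
  define inp where "inp = (\<lambda>(c1 :: real ^ 'd, c2 :: real ^ 'd, \<beta>). translation_input a c \<nu> p c1 c2 \<beta>)"
  define V where "V = {z. \<exists>v. \<forall>e. inp e v = Some (z e)}"
  have inV: "z \<in> V" if "\<And>c1 c2 \<beta>. translation_input a c \<nu> p c1 c2 \<beta> v = Some (z (c1, c2, \<beta>))" for z v
    using that by (auto simp: V_def inp_def intro!: exI[of _ v])
  define h where "h = (\<lambda>(c1 :: real ^ 'd, c2 :: real ^ 'd, \<beta> :: nat \<Rightarrow> complex). c2 - c1)"
  define x where "x n = (\<lambda>(c1 :: real ^ 'd, c2 :: real ^ 'd, \<beta>). embed_stored a c \<nu> p \<beta> (mi_rank \<nu> n))" for n
  define \<sigma> where "\<sigma> q = (\<lambda>(c1, c2, \<beta>). shifted_coeff a c \<nu> p (c2 - c1) \<beta> q)" for q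
  define \<psi> where "\<psi> l = (\<lambda>(c1, c2, \<beta>). translated_coeff a c \<nu> p c1 c2 \<beta> l)" for l
  have zero: "(\<lambda>_. 0) \<in> V" by (rule inV[of Zero]) simp
  have one: "(\<lambda>_. 1) \<in> V" by (rule inV[of One]) simp
  have aV: "(\<lambda>_. a m) \<in> V" if "m \<in> mi_upto c" for m by (rule inV[of "Coeff m"]) (simp add: that)
  have xV: "x n \<in> V" for n
  proof (cases "mi_rank \<nu> n \<in> stored_idx a c \<nu> p")
    case True
    then show ?thesis by (intro inV[of "Stored (mi_rank \<nu> n)"]) (simp add: x_def embed_stored_def)
  next
    case False
    then have "x n = (\<lambda>_. 0)" by (auto simp: x_def embed_stored_def)
    then show ?thesis using zero by simp
  qed
  let ?H = "range (\<lambda>k e. of_real (h e $ k))"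
  have "derivable V (?d * 1) ?H"
  proof (rule derivable_each)
    fix k
    show "derivable V 1 {\<lambda>e. of_real (h e $ k)}"
    proof (rule derivable_op[where f = Sub])
      show "(\<lambda>(c1, c2, \<beta>). of_real (c2 $ k)) \<in> V" by (rule inV[of "Center2 k"]) simp
      show "(\<lambda>(c1, c2, \<beta>). of_real (c1 $ k)) \<in> V" by (rule inV[of "Center1 k"]) simp
    qed (auto simp: h_def)
  qed simp
  then have H: "derivable V ?d ?H" by simp
  let ?t = "\<lambda>k j e. taylor_weight (h e) k j"
  let ?T = "\<Union>k. ?t k ` {..p}"
  have "derivable (V \<union> ?H) ((p + 1) * (2 * ?d + 1)) ?T"
    by (rule derivable_taylor_weights) (use zero one in auto)
  from derivable_trans[OF H this]
  have T: "derivable V (?d + (p + 1) * (2 * ?d + 1)) ?T" .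
  obtain m where m: "mi_deg m = c" "\<And>l. l \<in> stored_idx a c \<nu> p \<Longrightarrow> \<exists>k. \<nu> l $ k < m $ k"
    using leading_exponent[OF ord] by metis
  let ?S = "(\<lambda>q e. partial_shift (\<lambda>k j. ?t k j e) (\<lambda>i. x i e) UNIV q) ` mi_upto p"
  have "derivable (V \<union> ?T) (2 * mi_deg m * ?d * (p + 1) ^ ?d) ?S"
  proof (rule derivable_shift_of_slices)
    fix q assume "x q \<noteq> (\<lambda>_. 0)"
    then have "mi_rank \<nu> q \<in> stored_idx a c \<nu> p" by (auto simp: x_def embed_stored_def fun_eq_iff split: if_splits)
    then show "\<exists>k. q $ k < m $ k" using m(2) mi_rank(2)[OF ord(1)] by metis
  qed (use zero xV in auto)
  then have S0: "derivable (V \<union> ?T) (2 * c * ?d * (p + 1) ^ ?d) ?S" by (simp only: m(1))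
  have "\<sigma> ` {1..?N} = ?S"
  proof -
    have "\<sigma> (mi_rank \<nu> q) = (\<lambda>e. partial_shift (\<lambda>k j. ?t k j e) (\<lambda>i. x i e) UNIV q)"
      if "q \<in> mi_upto p" for q
      using shifted_coeff_eq_partial_shift[OF ord(1) that]
      by (auto simp: \<sigma>_def x_def h_def fun_eq_iff)
    then have "\<sigma> ` mi_rank \<nu> ` mi_upto p = ?S" by (auto simp: image_image)
    then show ?thesis by (simp add: mi_rank_image[OF ord(1)])
  qed
  with S0 derivable_trans[OF T, of "2 * c * ?d * (p + 1) ^ ?d" "\<sigma> ` {1..?N}"]
  have S: "derivable V (?d + (p + 1) * (2 * ?d + 1) + 2 * c * ?d * (p + 1) ^ ?d) (\<sigma> ` {1..?N})"
    by simp
  have "derivable (V \<union> \<sigma> ` {1..?N}) (?N * (4 * ?C + 3)) (\<psi> ` stored_idx a c \<nu> p)"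
  proof (rule derivable_compress[OF ord])
    fix l and e :: "(real ^ 'd) \<times> (real ^ 'd) \<times> (nat \<Rightarrow> complex)"
    assume l: "l \<in> stored_idx a c \<nu> p"
    obtain c1 c2 \<beta> where "e = (c1, c2, \<beta>)" by (cases e)
    then show "\<psi> l e = \<sigma> l e - (\<Sum>i\<in>{1..mi_count TYPE('d) (p - c)}. pde_mat a c \<nu> i l *
        (\<Sum>q\<in>elim_idx a c \<nu> p. elim_inv a c \<nu> p q i * \<sigma> q e))"
      using translated_coeff_eq[OF ord l] by (simp only: \<psi>_def \<sigma>_def prod.case)
  qed (use zero aV in auto)
  from derivable_trans[OF S this]
  have "derivable V (?d + (p + 1) * (2 * ?d + 1) + 2 * c * ?d * (p + 1) ^ ?d + ?N * (4 * ?C + 3))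
    (\<psi> ` stored_idx a c \<nu> p)" .
  then obtain P out where P: "length P \<le> ?d + (p + 1) * (2 * ?d + 1) + 2 * c * ?d * (p + 1) ^ ?d + ?N * (4 * ?C + 3)"
    "\<And>e. computes_on (inp e) P out (stored_idx a c \<nu> p) (\<lambda>l. \<psi> l e)"
    using program_of_derivable[of inp _ \<psi>] unfolding V_def by blast
  have p1: "p + 1 \<le> (p + 1) ^ ?d" using self_le_power[of "p + 1" ?d] by simp
  have "?d \<le> ?d * (p + 1) ^ ?d" by simp
  moreover have "(p + 1) * (2 * ?d + 1) \<le> (p + 1) ^ ?d * (2 * ?d + 1)" using p1 by (rule mult_right_mono) simp
  moreover have "?N * (4 * ?C + 3) \<le> (p + 1) ^ ?d * (4 * ?C + 3)"
    unfolding mi_count_def by (intro mult_right_mono card_mi_upto) simp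
  ultimately have "length P \<le> ?d * (p + 1) ^ ?d + (p + 1) ^ ?d * (2 * ?d + 1)
      + 2 * c * ?d * (p + 1) ^ ?d + (p + 1) ^ ?d * (4 * ?C + 3)"
    using P(1) by linarith
  also have "\<dots> = (3 * ?d + 2 * c * ?d + 4 * ?C + 4) * (p + 1) ^ ?d"
    by (simp add: algebra_simps)
  finally have "length P \<le> (3 * ?d + 2 * c * ?d + 4 * ?C + 4) * (p + 1) ^ ?d" .
  moreover have "computes_on (translation_input a c \<nu> p c1 c2 \<beta>) P out
      (stored_idx a c \<nu> p) (translated_coeff a c \<nu> p c1 c2 \<beta>)" for c1 c2 \<beta>
    using P(2)[of "(c1, c2, \<beta>)"] by (simp add: inp_def \<psi>_def)
  ultimately show ?thesis by blast
qed

text \<open>Only the values at \<open>p \<ge> c\<close> matter; there \<open>p \<ge> 1\<close>, so \<open>p + 1 \<le> 2 p\<close> absorbs the shift by one.\<close>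
theorem theorem20:
  fixes a :: "nat ^ 'd \<Rightarrow> complex" and c :: nat and \<nu> :: "nat \<Rightarrow> nat ^ 'd"
  assumes "c \<ge> 1"
    and "\<exists>m. mi_deg m = c \<and> a m \<noteq> 0"
    and "graded_monomial_ordering \<nu>"
  shows "\<exists>(prog :: nat \<Rightarrow> 'd tr_input instr list) (out :: nat \<Rightarrow> nat \<Rightarrow> 'd tr_input operand).
           (\<forall>p\<ge>c. \<forall>(c1 :: real ^ 'd) (c2 :: real ^ 'd) (\<beta> :: nat \<Rightarrow> complex).
              computes_on (translation_input a c \<nu> p c1 c2 \<beta>) (prog p) (out p)
                (stored_idx a c \<nu> p) (translated_coeff a c \<nu> p c1 c2 \<beta>)) \<and>
           (\<lambda>p. real (length (prog p))) \<in> O(\<lambda>p. real p ^ CARD('d))"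
proof -
  define K where "K = 3 * CARD('d) + 2 * c * CARD('d) + 4 * mi_count TYPE('d) c + 4"
  have "\<forall>p\<in>{c..}. \<exists>P out. length P \<le> K * (p + 1) ^ CARD('d) \<and>
    (\<forall>c1 c2 \<beta>. computes_on (translation_input a c \<nu> p c1 c2 \<beta>) P out
      (stored_idx a c \<nu> p) (translated_coeff a c \<nu> p c1 c2 \<beta>))"
    unfolding K_def using translation_program[OF assms(3,2)] by simp
  then obtain prog out where prog: "\<forall>p\<in>{c..}. length (prog p) \<le> K * (p + 1) ^ CARD('d) \<and>
    (\<forall>c1 c2 \<beta>. computes_on (translation_input a c \<nu> p c1 c2 \<beta>) (prog p) (out p)
      (stored_idx a c \<nu> p) (translated_coeff a c \<nu> p c1 c2 \<beta>))"
    by metis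
  have "(\<lambda>p. real (length (prog p))) \<in> O(\<lambda>p. real p ^ CARD('d))"
  proof (rule bigoI[where c = "real K * 2 ^ CARD('d)"], rule eventually_sequentiallyI[of c])
    fix p assume p: "c \<le> p"
    have "length (prog p) \<le> K * (p + 1) ^ CARD('d)" using prog p by simp
    also have "\<dots> \<le> K * (2 * p) ^ CARD('d)"
      using p assms(1) by (intro mult_left_mono power_mono) auto
    finally have "real (length (prog p)) \<le> real (K * (2 * p) ^ CARD('d))" by (rule of_nat_mono)
    then show "norm (real (length (prog p))) \<le> real K * 2 ^ CARD('d) * norm (real p ^ CARD('d))"
      by (simp add: power_mult_distrib mult.assoc)
  qed
  then show ?thesis using prog by (intro exI[of _ prog] exI[of _ out]) auto
qed

end
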